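(* Let $B$ be a finite non-zero skew brace with $B = A_1 + A_2$, where $A_1$ and $A_2$ are abelian skew subbraces of $B$. If $A_1$ is a left ideal of $B$, then there exists a non-zero strong left ideal of $B$ contained in $A_1$ or in $A_2$.
   Context: A (left) skew brace $(B,+,\cdot)$ is a set with two group structures $(B,+)$ and $(B,\cdot)$ (neither assumed abelian) such that $a(b+c) = ab - a + ac$ for all $a,b,c\in B$. Put $a * b = -a + ab - b$. $X*Y$ denotes the subgroup of $(B,+)$ generated by $\{x*y : x\in X,y\in Y\}$; $X+Y=\{x+y : x\in X,y\in Y\}$. A subbrace of $B$ is a subset that is a subgroup of both $(B,+)$ and $(B,\cdot)$. A skew brace is trivial if $a*b=0$ for all $a,b$ (equivalently, the two operations coincide), and abelian if it is trivial and its additive group is abelian. A subbrace $L$ is a left ideal if $B*L\subseteq L$. A strong left ideal is a left ideal $I$ such that $(I,+)$ is a normal subgroup of $(B,+)$. *)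

theory Defs
  imports "HOL-Algebra.Algebra"
begin

text \<open>
  The two operations of a skew brace are carried by a ring record: \<open>\<oplus>\<close>, \<open>\<zero>\<close>, \<open>\<ominus>\<close> for the additive
  group and \<open>\<otimes>\<close>, \<open>\<one>\<close>, \<open>inv\<close> for the multiplicative one. Neither group is assumed to be commutative,
  so \<open>B\<close> is not a ring in the sense of the locale \<open>ring\<close>, and the order of additive terms matters.
\<close>

locale skew_brace =
  fixes B (structure)
  assumes additive_group: "group (add_monoid B)"
    and multiplicative_group: "group B"
    and skew_distrib:
      "\<lbrakk> a \<in> carrier B; b \<in> carrier B; c \<in> carrier B \<rbrakk>
        \<Longrightarrow> a \<otimes> (b \<oplus> c) = a \<otimes> b \<ominus> a \<oplus> a \<otimes> c"

definition star :: "('a, 'm) ring_scheme \<Rightarrow> 'a \<Rightarrow> 'a \<Rightarrow> 'a" (infixl \<open>\<star>\<index>\<close> 70)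
  where "a \<star>\<^bsub>B\<^esub> b = \<ominus>\<^bsub>B\<^esub> a \<oplus>\<^bsub>B\<^esub> a \<otimes>\<^bsub>B\<^esub> b \<ominus>\<^bsub>B\<^esub> b"

definition star_set :: "('a, 'm) ring_scheme \<Rightarrow> 'a set \<Rightarrow> 'a set \<Rightarrow> 'a set"
  where "star_set B S T = generate (add_monoid B) {x \<star>\<^bsub>B\<^esub> y |x y. x \<in> S \<and> y \<in> T}"

locale trivial_skew_brace = skew_brace +
  assumes star_trivial: "\<lbrakk> a \<in> carrier B; b \<in> carrier B \<rbrakk> \<Longrightarrow> a \<star> b = \<zero>"

locale abelian_skew_brace = trivial_skew_brace +
  assumes additive_comm_group: "comm_group (add_monoid B)"

locale subbrace =
  fixes A and B (structure)
  assumes additive_subgroup: "subgroup A (add_monoid B)"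
    and multiplicative_subgroup: "subgroup A B"

locale left_ideal = subbrace L B for L and B (structure) +
  assumes star_closed: "star_set B (carrier B) L \<subseteq> L"

locale strong_left_ideal = left_ideal I B for I and B (structure) +
  assumes additive_normal: "I \<lhd> add_monoid B"

text \<open>
  A subbrace \<open>A\<close>, viewed as a skew brace in its own right, is \<open>B\<lparr>carrier := A\<rparr>\<close>.
\<close>

lemma (in skew_brace) subbrace_is_skew_brace:
  assumes "subbrace A B"
  shows "skew_brace (B\<lparr>carrier := A\<rparr>)"
proof -
  interpret subbrace A B by fact
  interpret add: group "add_monoid B" by (rule additive_group)
  interpret mult: group B by (rule multiplicative_group)
  have sub: "A \<subseteq> carrier B"
    using multiplicative_subgroup by (rule subgroup.subset)
  have minus: "\<ominus>\<^bsub>B\<lparr>carrier := A\<rparr>\<^esub> a = \<ominus> a" if "a \<in> A" for a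
    using add.m_inv_consistent[OF additive_subgroup that] by (simp add: a_inv_def)
  show ?thesis
  proof (rule skew_brace.intro)
    show "group (add_monoid (B\<lparr>carrier := A\<rparr>))"
      using add.subgroup_imp_group[OF additive_subgroup] by simp
    show "group (B\<lparr>carrier := A\<rparr>)"
      by (rule mult.subgroup_imp_group[OF multiplicative_subgroup])
    show "a \<otimes>\<^bsub>B\<lparr>carrier := A\<rparr>\<^esub> (b \<oplus>\<^bsub>B\<lparr>carrier := A\<rparr>\<^esub> c)
        = a \<otimes>\<^bsub>B\<lparr>carrier := A\<rparr>\<^esub> b \<ominus>\<^bsub>B\<lparr>carrier := A\<rparr>\<^esub> a
          \<oplus>\<^bsub>B\<lparr>carrier := A\<rparr>\<^esub> a \<otimes>\<^bsub>B\<lparr>carrier := A\<rparr>\<^esub> c"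
      if "a \<in> carrier (B\<lparr>carrier := A\<rparr>)" "b \<in> carrier (B\<lparr>carrier := A\<rparr>)"
        "c \<in> carrier (B\<lparr>carrier := A\<rparr>)" for a b c
      using that sub skew_distrib[of a b c] by (auto simp: a_minus_def minus)
  qed
qed

end

theory Submission
  imports Defs
begin

text \<open>
  Each \<open>\<lambda>\<^sub>a b = - a + a b\<close> is an automorphism of \<open>(B, +)\<close>, and it maps \<open>A1\<close> to itself because \<open>A1\<close> is a
  left ideal. A normal subgroup of \<open>(B, +)\<close> that is invariant under all \<open>\<lambda>\<^sub>a\<close> is a strong left ideal, so
  it suffices to find, in a finite group \<open>G = A B \<noteq> 1\<close> with \<open>A\<close> and \<open>B\<close> abelian, a nontrivial normal
  subgroup inside \<open>A\<close> or \<open>B\<close> that is invariant under every automorphism of \<open>G\<close> preserving \<open>A\<close>.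

  If the core of \<open>A\<close> is nontrivial, take the core. Otherwise the center of \<open>G\<close> lies in \<open>B\<close>, and we may
  assume that it is trivial; then \<open>A\<close> is its own centralizer, \<open>A \<inter> B = 1\<close>, and only \<open>1 \<in> A\<close> centralizes
  \<open>D = [G, G]\<close>, which is abelian by Ito's theorem. Let \<open>P \<noteq> 1\<close> be a Sylow \<open>p\<close>-subgroup of \<open>D\<close> and \<open>T\<close> the
  largest normal \<open>p\<close>-subgroup of \<open>G\<close> inside \<open>A P\<close>. As \<open>(A \<inter> B P) P\<close> is a normal \<open>p\<close>-subgroup containing
  \<open>B \<inter> A P\<close>, so does \<open>T\<close>, hence \<open>T = (T \<inter> A) (T \<inter> B)\<close> and the center of \<open>T\<close> factorizes likewise. It is
  centralized by \<open>D\<close>, so its part in \<open>A\<close> is trivial: the center of \<open>T\<close> is the required subgroup, in \<open>B\<close>.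
\<close>

subsection \<open>Centralizers and finite \<open>p\<close>-groups\<close>

text \<open>The parameter \<open>H\<close> lets one notion serve as centralizer in the group
  (\<open>H = carrier G\<close>), as center of a subgroup (\<open>H = K\<close>) and as the part of
  \<open>A\<close> that centralizes the derived subgroup.\<close>

definition centralizer_in :: "('a, 'm) monoid_scheme \<Rightarrow> 'a set \<Rightarrow> 'a set \<Rightarrow> 'a set"
  where "centralizer_in G H K = {x \<in> H. \<forall>y\<in>K. x \<otimes>\<^bsub>G\<^esub> y = y \<otimes>\<^bsub>G\<^esub> x}"

lemma centralizer_inI:
  assumes "x \<in> H" "\<And>y. y \<in> K \<Longrightarrow> x \<otimes>\<^bsub>G\<^esub> y = y \<otimes>\<^bsub>G\<^esub> x"
  shows "x \<in> centralizer_in G H K"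
  using assms by (simp add: centralizer_in_def)

lemma centralizer_inD:
  assumes "x \<in> centralizer_in G H K"
  shows "x \<in> H" "y \<in> K \<Longrightarrow> x \<otimes>\<^bsub>G\<^esub> y = y \<otimes>\<^bsub>G\<^esub> x"
  using assms by (simp_all add: centralizer_in_def)

context group
begin

lemma mult_inv_cancel:
  assumes "x \<in> carrier G" "y \<in> carrier G"
  shows "x \<otimes> (inv x \<otimes> y) = y" "inv x \<otimes> (x \<otimes> y) = y"
  using assms by (simp_all flip: m_assoc)

lemma subgroup_centralizer_in:
  assumes H: "subgroup H G" and K: "K \<subseteq> carrier G"
  shows "subgroup (centralizer_in G H K) G"
proof (rule subgroupI)
  show "centralizer_in G H K \<subseteq> carrier G"
    using subgroup.subset[OF H] by (auto simp: centralizer_in_def)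
  show "centralizer_in G H K \<noteq> {}"
    using subgroup.one_closed[OF H] K by (force simp: centralizer_in_def)
next
  fix x assume x: "x \<in> centralizer_in G H K"
  hence xG: "x \<in> carrier G" using subgroup.subset[OF H] by (auto simp: centralizer_in_def)
  have "inv x \<otimes> y = y \<otimes> inv x" if "y \<in> K" for y
  proof -
    have y: "y \<in> carrier G" using that K by auto
    have "x \<otimes> y = y \<otimes> x" using x that by (auto simp: centralizer_in_def)
    hence "inv x \<otimes> (x \<otimes> y) \<otimes> inv x = inv x \<otimes> (y \<otimes> x) \<otimes> inv x" by simp
    thus ?thesis using xG y by (simp add: m_assoc mult_inv_cancel)
  qed
  thus "inv x \<in> centralizer_in G H K"
    using x subgroup.m_inv_closed[OF H] by (auto simp: centralizer_in_def)
next
  fix x y assume xy: "x \<in> centralizer_in G H K" "y \<in> centralizer_in G H K"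
  hence xG: "x \<in> carrier G" "y \<in> carrier G"
    using subgroup.subset[OF H] by (auto simp: centralizer_in_def)
  have "x \<otimes> y \<otimes> z = z \<otimes> (x \<otimes> y)" if "z \<in> K" for z
  proof -
    have z: "z \<in> carrier G" using that K by auto
    have "x \<otimes> z = z \<otimes> x" "y \<otimes> z = z \<otimes> y" using xy that by (auto simp: centralizer_in_def)
    thus ?thesis using xG z by (metis m_assoc)
  qed
  thus "x \<otimes> y \<in> centralizer_in G H K"
    using xy subgroup.m_closed[OF H] by (auto simp: centralizer_in_def)
qed

lemma conj_mult:
  assumes "g \<in> carrier G" "x \<in> carrier G" "y \<in> carrier G"
  shows "g \<otimes> (x \<otimes> y) \<otimes> inv g = (g \<otimes> x \<otimes> inv g) \<otimes> (g \<otimes> y \<otimes> inv g)"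
  using assms by (simp add: m_assoc mult_inv_cancel)

text \<open>Every \<open>y\<close> in \<open>K\<close> is a conjugate \<open>g z g^-1\<close> with
  \<open>z\<close> in \<open>K\<close>, so conjugating \<open>x z = z x\<close> by \<open>g\<close>
  gives the relation required of \<open>g x g^-1\<close> and \<open>y\<close>.\<close>

lemma normal_centralizer_in:
  assumes H: "H \<lhd> G" and K: "K \<lhd> G"
  shows "centralizer_in G H K \<lhd> G"
proof (rule normal_invI)
  show "subgroup (centralizer_in G H K) G"
    using subgroup_centralizer_in normal_imp_subgroup[OF H]
      subgroup.subset[OF normal_imp_subgroup[OF K]] by blast
  fix g x assume g: "g \<in> carrier G" and x: "x \<in> centralizer_in G H K"
  hence xH: "x \<in> H" and xK: "\<And>y. y \<in> K \<Longrightarrow> x \<otimes> y = y \<otimes> x"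
    by (auto simp: centralizer_in_def)
  have xG: "x \<in> carrier G" using xH normal_imp_subgroup[OF H] subgroup.mem_carrier by metis
  have "(g \<otimes> x \<otimes> inv g) \<otimes> y = y \<otimes> (g \<otimes> x \<otimes> inv g)" if "y \<in> K" for y
  proof -
    have y: "y \<in> carrier G" using that normal_imp_subgroup[OF K] subgroup.mem_carrier by metis
    let ?z = "inv g \<otimes> y \<otimes> g"
    have z: "?z \<in> K" using normal.inv_op_closed1[OF K g that] .
    have yz: "y = g \<otimes> ?z \<otimes> inv g" using g y by (simp add: m_assoc mult_inv_cancel)
    have zG: "?z \<in> carrier G" using g y by simp
    show ?thesis
      using conj_mult[OF g xG zG] conj_mult[OF g zG xG] xK[OF z] yz by metis
  qed
  thus "g \<otimes> x \<otimes> inv g \<in> centralizer_in G H K"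
    using normal_invE(2)[OF H g xH] by (auto simp: centralizer_in_def)
qed

lemma normal_set_mult:
  assumes H: "H \<lhd> G" and K: "K \<lhd> G"
  shows "H <#> K \<lhd> G"
proof (rule normal_invI)
  interpret second_isomorphism_grp H G K
    using H normal_imp_subgroup[OF K]
    by (simp add: second_isomorphism_grp_def second_isomorphism_grp_axioms_def)
  show "subgroup (H <#> K) G" by (rule normal_set_mult_subgroup)
  fix g x assume g: "g \<in> carrier G" and "x \<in> H <#> K"
  then obtain h k where hk: "h \<in> H" "k \<in> K" "x = h \<otimes> k" by (auto simp: set_mult_def)
  have "h \<in> carrier G" "k \<in> carrier G"
    using hk normal_imp_subgroup[OF H] normal_imp_subgroup[OF K] subgroup.mem_carrier by metis+
  hence "g \<otimes> x \<otimes> inv g = (g \<otimes> h \<otimes> inv g) \<otimes> (g \<otimes> k \<otimes> inv g)"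
    using conj_mult[OF g] hk by simp
  thus "g \<otimes> x \<otimes> inv g \<in> H <#> K"
    using normal_invE(2)[OF H g hk(1)] normal_invE(2)[OF K g hk(2)]
    by (auto simp: set_mult_def)
qed

lemma set_mult_subgroup_right_normal:
  assumes "subgroup H G" "K \<lhd> G"
  shows "subgroup (H <#> K) G"
proof -
  interpret second_isomorphism_grp K G H
    using assms by (simp add: second_isomorphism_grp_def second_isomorphism_grp_axioms_def)
  show ?thesis
    using normal_set_mult_subgroup commut_normal[OF assms] by simp
qed

text \<open>All fibres of the multiplication map from \<open>H \<times> K\<close> onto
  \<open>H <#> K\<close> have \<open>card (H \<inter> K)\<close> elements; counting pairs fibre by
  fibre gives the product formula.\<close>

lemma card_set_mult:
  assumes fin: "finite (carrier G)" and H: "subgroup H G" and K: "subgroup K G"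
  shows "card (H <#> K) * card (H \<inter> K) = card H * card K"
proof -
  have HG: "H \<subseteq> carrier G" and KG: "K \<subseteq> carrier G"
    using H K subgroup.subset by auto
  have finH: "finite H" and finK: "finite K" using HG KG fin finite_subset by auto
  let ?f = "\<lambda>(h, k). h \<otimes> k"
  have img: "?f ` (H \<times> K) = H <#> K" by (auto simp: set_mult_def)
  have fibre: "card {q \<in> H \<times> K. ?f q = y} = card (H \<inter> K)" if y: "y \<in> H <#> K" for y
  proof -
    obtain h k where hk: "h \<in> H" "k \<in> K" "y = h \<otimes> k" using y by (auto simp: set_mult_def)
    have G: "h \<in> carrier G" "k \<in> carrier G" using hk HG KG by auto
    \<comment> \<open>Given one factorization \<open>h k\<close> of \<open>y\<close>, the others are
      \<open>(h x) (x^-1 k)\<close> with \<open>x\<close> in \<open>H \<inter> K\<close>.\<close>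
    have "bij_betw (\<lambda>x. (h \<otimes> x, inv x \<otimes> k)) (H \<inter> K) {q \<in> H \<times> K. ?f q = y}"
    proof (rule bij_betw_imageI)
      show "inj_on (\<lambda>x. (h \<otimes> x, inv x \<otimes> k)) (H \<inter> K)"
        using G HG by (intro inj_onI) (auto simp: subset_iff)
      show "(\<lambda>x. (h \<otimes> x, inv x \<otimes> k)) ` (H \<inter> K) = {q \<in> H \<times> K. ?f q = y}"
      proof (intro equalityI subsetI)
        fix q assume "q \<in> (\<lambda>x. (h \<otimes> x, inv x \<otimes> k)) ` (H \<inter> K)"
        then obtain x where x: "x \<in> H" "x \<in> K" "q = (h \<otimes> x, inv x \<otimes> k)" by auto
        have xG: "x \<in> carrier G" using x HG by auto
        have "h \<otimes> x \<otimes> (inv x \<otimes> k) = h \<otimes> k" using G xG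
          by (simp add: m_assoc mult_inv_cancel)
        thus "q \<in> {q \<in> H \<times> K. ?f q = y}"
          using x hk H K by (auto intro: subgroup.m_closed subgroup.m_inv_closed)
      next
        fix q assume "q \<in> {q \<in> H \<times> K. ?f q = y}"
        then obtain a b where q: "q = (a, b)" "a \<in> H" "b \<in> K" "a \<otimes> b = h \<otimes> k" using hk by auto
        have abG: "a \<in> carrier G" "b \<in> carrier G" using q HG KG by auto
        let ?x = "inv h \<otimes> a"
        have "?x \<in> H" using q hk H by (auto intro: subgroup.m_closed subgroup.m_inv_closed)
        moreover have "?x = k \<otimes> inv b"
        proof -
          have "inv h \<otimes> (a \<otimes> b) \<otimes> inv b = inv h \<otimes> (h \<otimes> k) \<otimes> inv b" using q(4) by simp
          thus ?thesis using G abG by (simp add: m_assoc mult_inv_cancel)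
        qed
        moreover from this have "?x \<in> K" using q hk K
          by (auto intro: subgroup.m_closed subgroup.m_inv_closed)
        moreover have "h \<otimes> ?x = a" using G abG by (simp add: mult_inv_cancel)
        moreover have "inv ?x \<otimes> k = b"
          unfolding \<open>?x = k \<otimes> inv b\<close> using G abG by (simp add: inv_mult_group m_assoc)
        ultimately show "q \<in> (\<lambda>x. (h \<otimes> x, inv x \<otimes> k)) ` (H \<inter> K)" using q by force
      qed
    qed
    thus ?thesis by (simp add: bij_betw_same_card)
  qed
  have "card H * card K = (\<Sum>q\<in>H \<times> K. 1)" by (simp add: card_cartesian_product)
  also have "\<dots> = (\<Sum>y\<in>H <#> K. \<Sum>q\<in>{q \<in> H \<times> K. ?f q = y}. 1)"
    using sum.image_gen[of "H \<times> K" "\<lambda>_. 1::nat" ?f] finH finK img by simp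
  also have "\<dots> = (\<Sum>y\<in>H <#> K. card (H \<inter> K))"
    by (rule sum.cong) (use fibre in auto)
  finally show ?thesis by simp
qed

lemma pow_card_subgroup:
  assumes "finite (carrier G)" "subgroup H G" "x \<in> H"
  shows "x [^] card H = \<one>"
proof -
  interpret H: group "G\<lparr>carrier := H\<rparr>" using subgroup_imp_group assms(2) .
  have "x [^]\<^bsub>G\<lparr>carrier := H\<rparr>\<^esub> order (G\<lparr>carrier := H\<rparr>) = \<one>"
    using H.pow_order_eq_1 assms(3) by simp
  thus ?thesis by (simp add: order_def nat_pow_consistent[symmetric])
qed

lemma subgroup_nat_pow_closed:
  fixes n :: nat
  assumes "subgroup H G" "x \<in> H"
  shows "x [^] n \<in> H"
  using subgroup_int_pow_closed[OF assms, of "int n"] by (simp add: int_pow_int)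

text \<open>By Bezout, \<open>x\<close> is a power of \<open>x [^] m\<close> times a power of
  \<open>x [^] n\<close>.\<close>

lemma coprime_pow_mem:
  fixes m n :: nat
  assumes H: "subgroup H G" and x: "x \<in> carrier G" and "x [^] m \<in> H" "x [^] n \<in> H"
    and "coprime m n"
  shows "x \<in> H"
proof -
  obtain u v where uv: "u * int m + v * int n = 1"
    using assms(5) bezout_int[of "int m" "int n"] by auto
  have "x = x [^] (int m * u + int n * v)" using uv x by (simp add: mult.commute)
  also have "\<dots> = (x [^] int m) [^] u \<otimes> (x [^] int n) [^] v"
    using x by (simp add: int_pow_mult int_pow_pow)
  also have "\<dots> = (x [^] m) [^] u \<otimes> (x [^] n) [^] v" by (simp add: int_pow_int)
  also have "\<dots> \<in> H"
    using assms(3,4) by (intro subgroup.m_closed[OF H] subgroup_int_pow_closed[OF H])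
  finally show ?thesis .
qed

lemma coprime_pow_eq_one:
  fixes m n :: nat
  assumes "x \<in> carrier G" "x [^] m = \<one>" "x [^] n = \<one>" "coprime m n"
  shows "x = \<one>"
  using coprime_pow_mem[OF triv_subgroup assms(1)] assms by simp

text \<open>A Sylow \<open>p\<close>-subgroup of \<open>H\<close> is nontrivial, and its elements
  are killed by its order, the full power of \<open>p\<close> in \<open>card H\<close>.\<close>

lemma exists_element_of_prime_power_order:
  assumes fin: "finite (carrier G)" and H: "subgroup H G" and p: "Factorial_Ring.prime p" "p dvd card H"
  obtains x where "x \<in> H" "x \<noteq> \<one>" "x [^] (p ^ multiplicity p (card H)) = \<one>"
proof -
  interpret H: group "G\<lparr>carrier := H\<rparr>" using subgroup_imp_group[OF H] .
  have finH: "finite H" using H fin finite_subset subgroup.subset by metis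
  have pos: "card H > 0" using H fin subgroup.finite_imp_card_positive by metis
  let ?a = "multiplicity p (card H)"
  obtain m where m: "card H = p ^ ?a * m" using multiplicity_dvd by (metis dvdE)
  obtain Q where Q: "subgroup Q (G\<lparr>carrier := H\<rparr>)" "card Q = p ^ ?a"
    using sylow_thm[OF p(1) H.is_group, of ?a m] m finH by (auto simp: order_def)
  have QG: "subgroup Q G" and QH: "Q \<subseteq> H"
    using incl_subgroup[OF H Q(1)] subgroup.subset[OF Q(1)] by auto
  have "?a \<ge> 1" using p pos by (simp add: prime_multiplicity_gt_zero_iff Suc_le_eq)
  hence "card Q > 1" using Q p(1) by (metis One_nat_def Suc_le_eq one_less_power prime_gt_1_nat)
  then obtain x where "x \<in> Q" "x \<noteq> \<one>"
    using card_le_Suc0_iff_eq[of Q] card.infinite subgroup.one_closed[OF QG]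
    by (metis One_nat_def linorder_not_less not_one_less_zero)
  thus ?thesis using that QH pow_card_subgroup[OF fin QG] Q(2) by auto
qed

text \<open>A prime divisor \<open>q\<close> other than \<open>p\<close> would yield an element
  different from \<open>\<one>\<close> that is killed by a power of \<open>q\<close> and by a power
  of \<open>p\<close>.\<close>

lemma card_prime_power_of_torsion:
  assumes fin: "finite (carrier G)" and H: "subgroup H G" and p: "Factorial_Ring.prime p"
    and tors: "\<And>x. x \<in> H \<Longrightarrow> x [^] (p ^ n) = \<one>"
  shows "\<exists>k. card H = p ^ k"
proof -
  have pos: "card H > 0" using H fin subgroup.finite_imp_card_positive by metis
  have "q = p" if q: "Factorial_Ring.prime q" "q dvd card H" for q
  proof (rule ccontr)
    assume "q \<noteq> p"
    obtain x where x: "x \<in> H" "x \<noteq> \<one>" "x [^] (q ^ multiplicity q (card H)) = \<one>"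
      using exists_element_of_prime_power_order[OF fin H q] .
    have "coprime (q ^ multiplicity q (card H)) (p ^ n)"
      using q p \<open>q \<noteq> p\<close> primes_coprime by (metis coprime_power_left_iff coprime_power_right_iff)
    thus False using coprime_pow_eq_one[OF _ x(3) tors[OF x(1)]] x H subgroup.mem_carrier by metis
  qed
  moreover obtain k n where "\<not> p dvd n" "card H = n * p ^ k"
    using prime_power_canonical[OF p pos] by blast
  ultimately show ?thesis
    by (metis dvd_mult2 mult_1 prime_factor_nat)
qed

lemma prime_dvd_card_of_p_group:
  assumes fin: "finite (carrier G)" and H: "subgroup H G" and p: "Factorial_Ring.prime p"
    and card: "card H = p ^ n" and ne: "H \<noteq> {\<one>}"
  shows "p dvd card H"
proof -
  have "n \<noteq> 0"
  proof
    assume "n = 0"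
    hence "card H = 1" using card by simp
    then obtain x where "H = {x}" by (rule card_1_singletonE)
    thus False using ne subgroup.one_closed[OF H] by simp
  qed
  thus ?thesis using card by (cases n) auto
qed

text \<open>Class equation: the class of a non-central element has size divisible by
  \<open>p\<close>. With trivial center, \<open>{\<one>}\<close> would be the only other class, and
  the group order would be 1 modulo \<open>p\<close>.\<close>

lemma p_group_center_nontrivial:
  assumes p: "Factorial_Ring.prime p" and card: "card (carrier G) = p ^ n"
    and ne: "carrier G \<noteq> {\<one>}"
  shows "centralizer_in G (carrier G) (carrier G) \<noteq> {\<one>}"
proof
  assume triv: "centralizer_in G (carrier G) (carrier G) = {\<one>}"
  let ?\<phi> = "\<lambda>g. \<lambda>h\<in>carrier G. g \<otimes> h \<otimes> inv g"
  interpret act: group_action G "carrier G" ?\<phi> by (rule action_by_conjugation)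
  have fin: "finite (carrier G)"
    using card p by (metis card.infinite power_eq_0_iff not_prime_0)
  have pG: "p dvd card (carrier G)"
    using prime_dvd_card_of_p_group[OF fin subgroup_self p card ne] .
  have stab: "stabilizer G ?\<phi> x = {g \<in> carrier G. g \<otimes> x = x \<otimes> g}" if "x \<in> carrier G" for x
    using that by (auto simp: stabilizer_def inv_solve_right')
  have orbit_one: "orbit G ?\<phi> \<one> = {\<one>}"
  proof -
    have "orbit G ?\<phi> \<one> = (\<lambda>g. ?\<phi> g \<one>) ` carrier G" unfolding orbit_def by blast
    also have "\<dots> = (\<lambda>g. \<one>) ` carrier G" by (rule image_cong) auto
    finally show ?thesis using one_closed by auto
  qed
  have pdvd: "p dvd card orb" if orb: "orb \<in> orbits G (carrier G) ?\<phi>" "orb \<noteq> {\<one>}" for orb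
  proof -
    obtain x where x: "x \<in> carrier G" "orb = orbit G ?\<phi> x"
      using orb(1) by (auto simp: orbits_def)
    have eq: "card orb * card (stabilizer G ?\<phi> x) = p ^ n"
      using act.orbit_stabilizer_theorem[OF x(1)] x(2) card by (simp add: order_def)
    obtain k where k: "card orb = p ^ k"
      using divides_primepow_nat[OF p] dvdI[OF eq[symmetric]] by blast
    \<comment> \<open>An orbit of size 1 makes \<open>x\<close> central, hence
      \<open>x = \<one>\<close>, and the orbit would be the excluded
      \<open>{\<one>}\<close>.\<close>
    have "k \<noteq> 0"
    proof
      assume "k = 0"
      hence "card (stabilizer G ?\<phi> x) = card (carrier G)" using eq k card by simp
      hence "stabilizer G ?\<phi> x = carrier G"
        using card_subset_eq[OF fin act.stabilizer_subset] by simp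
      hence "{g \<in> carrier G. g \<otimes> x = x \<otimes> g} = carrier G" using stab[OF x(1)] by simp
      hence "x \<otimes> g = g \<otimes> x" if "g \<in> carrier G" for g
      proof -
        have "g \<in> {g \<in> carrier G. g \<otimes> x = x \<otimes> g}"
          using that \<open>{g \<in> carrier G. g \<otimes> x = x \<otimes> g} = carrier G\<close> by (simp only:)
        thus ?thesis by simp
      qed
      hence "x \<in> centralizer_in G (carrier G) (carrier G)"
        by (rule centralizer_inI[OF x(1)])
      hence "x = \<one>" using triv by simp
      thus False using x(2) orb(2) orbit_one by (simp only:)
    qed
    thus ?thesis using k by (cases k) auto
  qed
  have orb1: "{\<one>} \<in> orbits G (carrier G) ?\<phi>"
    unfolding orbits_def using orbit_one one_closed by blast
  have fino: "finite (orbits G (carrier G) ?\<phi>)"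
  proof -
    have "orbits G (carrier G) ?\<phi> = orbit G ?\<phi> ` carrier G" unfolding orbits_def by blast
    thus ?thesis using fin by simp
  qed
  have "card (carrier G) = (\<Sum>orb\<in>orbits G (carrier G) ?\<phi>. card orb)"
    using act.disjoint_sum[OF fin, of "\<lambda>_. 1::nat"] by simp
  also have "\<dots> = 1 + (\<Sum>orb\<in>orbits G (carrier G) ?\<phi> - {{\<one>}}. card orb)"
    using sum.remove[OF fino orb1, of card] by simp
  finally have "card (carrier G) = 1 + (\<Sum>orb\<in>orbits G (carrier G) ?\<phi> - {{\<one>}}. card orb)" .
  moreover have "p dvd (\<Sum>orb\<in>orbits G (carrier G) ?\<phi> - {{\<one>}}. card orb)"
    by (rule dvd_sum) (use pdvd in auto)
  ultimately have "p dvd 1" using pG dvd_add_left_iff[of p _ 1] by simp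
  thus False using p by (simp add: prime_gt_1_nat)
qed

lemma p_subgroup_center_nontrivial:
  assumes p: "Factorial_Ring.prime p" and H: "subgroup H G" and card: "card H = p ^ n"
    and ne: "H \<noteq> {\<one>}"
  shows "centralizer_in G H H \<noteq> {\<one>}"
proof -
  interpret H: group "G\<lparr>carrier := H\<rparr>" using subgroup_imp_group[OF H] .
  show ?thesis
    using H.p_group_center_nontrivial[OF p] card ne by (simp add: centralizer_in_def)
qed

end

subsection \<open>Products of two abelian subgroups\<close>

context group
begin

abbreviation commutator :: "'a \<Rightarrow> 'a \<Rightarrow> 'a"
  where "commutator x y \<equiv> x \<otimes> y \<otimes> inv x \<otimes> inv y"

lemma commutator_swap_mem:
  assumes "subgroup W G" "x \<in> carrier G" "y \<in> carrier G" "commutator x y \<in> W"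
  shows "commutator y x \<in> W"
proof -
  have "commutator y x = inv (commutator x y)"
    using assms(2,3) by (simp add: inv_mult_group m_assoc)
  thus ?thesis using subgroup.m_inv_closed[OF assms(1,4)] by simp
qed

text \<open>The identity \<open>[x y, z] = x [y, z] x^-1 [x, z]\<close> reduces commutators modulo a
  normal subgroup to those of the factors.\<close>

lemma commutator_mult_mem:
  assumes W: "W \<lhd> G" and G: "x \<in> carrier G" "y \<in> carrier G" "z \<in> carrier G"
    and xz: "commutator x z \<in> W" and yz: "commutator y z \<in> W"
  shows "commutator (x \<otimes> y) z \<in> W"
proof -
  have "commutator (x \<otimes> y) z = (x \<otimes> commutator y z \<otimes> inv x) \<otimes> commutator x z"
    using G by (simp add: inv_mult_group m_assoc mult_inv_cancel)
  thus ?thesis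
    using subgroup.m_closed[OF normal_imp_subgroup[OF W] normal_invE(2)[OF W G(1) yz] xz] by simp
qed

lemma conj_commutator:
  assumes "g \<in> carrier G" "x \<in> carrier G" "y \<in> carrier G"
  shows "g \<otimes> commutator x y \<otimes> inv g = commutator (g \<otimes> x \<otimes> inv g) (g \<otimes> y \<otimes> inv g)"
  using assms by (simp add: m_assoc inv_mult_group mult_inv_cancel)

text \<open>Two passes through centralizers: the generated subgroup first commutes with the
  generators, and therefore the generators, and all they generate, commute with it.\<close>

lemma generate_commute:
  assumes S: "S \<subseteq> carrier G" and comm: "\<And>x y. \<lbrakk> x \<in> S; y \<in> S \<rbrakk> \<Longrightarrow> x \<otimes> y = y \<otimes> x"
    and xy: "x \<in> generate G S" "y \<in> generate G S"
  shows "x \<otimes> y = y \<otimes> x"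
proof -
  have "generate G S \<subseteq> centralizer_in G (carrier G) S"
    using S comm
    by (intro generate_subgroup_incl subgroup_centralizer_in subgroup_self)
      (auto simp: centralizer_in_def)
  hence "generate G S \<subseteq> centralizer_in G (carrier G) (generate G S)"
    using S generate_incl[OF S]
    by (intro generate_subgroup_incl subgroup_centralizer_in subgroup_self)
      (force simp: centralizer_in_def)+
  thus ?thesis using xy by (auto simp: centralizer_in_def)
qed

end

text \<open>Here \<open>B\<close> is a subgroup and not the brace: the intended instance is the
  additive group of a skew brace, with \<open>A1\<close> and \<open>A2\<close> as the two
  factors.\<close>

locale abelian_factorization = group G for G (structure) +
  fixes A B
  assumes subA: "subgroup A G" and subB: "subgroup B G"
    and commA: "\<lbrakk> x \<in> A; y \<in> A \<rbrakk> \<Longrightarrow> x \<otimes> y = y \<otimes> x"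
    and commB: "\<lbrakk> x \<in> B; y \<in> B \<rbrakk> \<Longrightarrow> x \<otimes> y = y \<otimes> x"
    and factorization: "carrier G = A <#> B"
begin

lemma A_carrier: "x \<in> A \<Longrightarrow> x \<in> carrier G" and B_carrier: "x \<in> B \<Longrightarrow> x \<in> carrier G"
  using subA subB subgroup.mem_carrier by metis+

lemma obtain_AB:
  assumes "g \<in> carrier G"
  obtains a b where "a \<in> A" "b \<in> B" "g = a \<otimes> b"
  using assms factorization by (auto simp: set_mult_def)

text \<open>Factor \<open>inv g\<close> and invert: this turns the order of the two factors
  around.\<close>

lemma obtain_BA:
  assumes "g \<in> carrier G"
  obtains b a where "b \<in> B" "a \<in> A" "g = b \<otimes> a"
proof -
  obtain a b where ab: "a \<in> A" "b \<in> B" "inv g = a \<otimes> b"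
    using obtain_AB[of "inv g"] assms by auto
  have "g = inv (a \<otimes> b)" using ab assms by (metis inv_inv)
  hence "g = inv b \<otimes> inv a" using ab A_carrier B_carrier by (simp add: inv_mult_group)
  thus ?thesis
    using that ab subgroup.m_inv_closed[OF subA] subgroup.m_inv_closed[OF subB] by blast
qed

text \<open>Since \<open>y\<close> commutes with \<open>b\<close>, conjugating \<open>b\<close> by
  \<open>x y\<close> is the same as conjugating it by \<open>x\<close>.\<close>

lemma commutator_drop_left:
  assumes "x \<in> carrier G" "y \<in> B" "b \<in> B"
  shows "commutator (x \<otimes> y) b = commutator x b"
proof -
  have "x \<otimes> y \<otimes> b \<otimes> inv (x \<otimes> y) = x \<otimes> (b \<otimes> y) \<otimes> inv (x \<otimes> y)"
    using assms commB[of y b] B_carrier by (simp add: m_assoc)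
  also have "\<dots> = x \<otimes> b \<otimes> inv x"
    using assms B_carrier by (simp add: m_assoc inv_mult_group mult_inv_cancel)
  finally show ?thesis by simp
qed

text \<open>The factor \<open>x\<close> can be moved past \<open>inv a\<close> and then
  cancels.\<close>

lemma commutator_drop_right:
  assumes "a \<in> A" "y \<in> carrier G" "x \<in> A"
  shows "commutator a (y \<otimes> x) = commutator a y"
proof -
  have "commutator a (y \<otimes> x) = a \<otimes> y \<otimes> (x \<otimes> inv a) \<otimes> inv (y \<otimes> x)"
    using assms A_carrier by (simp add: m_assoc)
  also have "x \<otimes> inv a = inv a \<otimes> x"
    using assms commA[of x "inv a"] subgroup.m_inv_closed[OF subA] by simp
  also have "a \<otimes> y \<otimes> (inv a \<otimes> x) \<otimes> inv (y \<otimes> x) = commutator a y"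
    using assms A_carrier by (simp add: m_assoc inv_mult_group mult_inv_cancel)
  finally show ?thesis .
qed

text \<open>Conjugation by \<open>x\<close> is a homomorphism and fixes \<open>a\<close>, because
  \<open>A\<close> is abelian, so only the second entry changes.\<close>

lemma conj_A_commutator:
  assumes "x \<in> A" "a \<in> A" "b \<in> carrier G"
  shows "x \<otimes> commutator a b \<otimes> inv x = commutator a (x \<otimes> b \<otimes> inv x)"
proof -
  have "x \<otimes> a \<otimes> inv x = a"
    using assms A_carrier commA[of x a] by (simp add: m_assoc)
  thus ?thesis using conj_commutator[of x a b] assms A_carrier by simp
qed

lemma conj_B_commutator:
  assumes "x \<in> B" "a \<in> carrier G" "b \<in> B"
  shows "x \<otimes> commutator a b \<otimes> inv x = commutator (x \<otimes> a \<otimes> inv x) b"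
proof -
  have "x \<otimes> b \<otimes> inv x = b"
    using assms B_carrier commB[of x b] by (simp add: m_assoc)
  thus ?thesis using conj_commutator[of x a b] assms B_carrier by simp
qed

text \<open>Ito's computation: write \<open>x b x\<^sup>-\<^sup>1 = b' a'\<close> and \<open>y a y\<^sup>-\<^sup>1 = a'' b''\<close>. Both \<open>x y\<close> and \<open>y x\<close>
  conjugate \<open>[a, b]\<close> to \<open>[a'', b']\<close>, since the factors \<open>a'\<close> and \<open>b''\<close> drop out.\<close>

lemma commutators_commute:
  assumes x: "x \<in> A" and a: "a \<in> A" and y: "y \<in> B" and b: "b \<in> B"
  shows "commutator x y \<otimes> commutator a b = commutator a b \<otimes> commutator x y"
proof -
  have main: "x \<otimes> (y \<otimes> commutator a b \<otimes> inv y) \<otimes> inv x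
      = y \<otimes> (x \<otimes> commutator a b \<otimes> inv x) \<otimes> inv y"
    if x: "x \<in> A" and y: "y \<in> B" for x y
  proof -
    note G = A_carrier[OF x] A_carrier[OF a] B_carrier[OF y] B_carrier[OF b]
    obtain b' a' where 1: "b' \<in> B" "a' \<in> A" "x \<otimes> b \<otimes> inv x = b' \<otimes> a'"
      using obtain_BA[of "x \<otimes> b \<otimes> inv x"] G by auto
    obtain a'' b'' where 2: "a'' \<in> A" "b'' \<in> B" "y \<otimes> a \<otimes> inv y = a'' \<otimes> b''"
      using obtain_AB[of "y \<otimes> a \<otimes> inv y"] G by auto
    note G' = A_carrier[OF 1(2)] A_carrier[OF 2(1)] B_carrier[OF 1(1)] B_carrier[OF 2(2)]
    have "x \<otimes> commutator a b \<otimes> inv x = commutator a b'"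
      using conj_A_commutator[OF x a G(4)] 1 commutator_drop_right[OF a G'(3) 1(2)] by simp
    moreover have "y \<otimes> commutator a b' \<otimes> inv y = commutator a'' b'"
      using conj_B_commutator[OF y G(2) 1(1)] 2 commutator_drop_left[OF G'(2) 2(2) 1(1)] by simp
    moreover have "y \<otimes> commutator a b \<otimes> inv y = commutator a'' b"
      using conj_B_commutator[OF y G(2) b] 2 commutator_drop_left[OF G'(2) 2(2) b] by simp
    moreover have "x \<otimes> commutator a'' b \<otimes> inv x = commutator a'' b'"
      using conj_A_commutator[OF x 2(1) G(4)] 1 commutator_drop_right[OF 2(1) G'(3) 1(2)] by simp
    ultimately show ?thesis by simp
  qed
  let ?x = "inv x" and ?y = "inv y" and ?c = "commutator a b"
  note G = A_carrier[OF x] A_carrier[OF a] B_carrier[OF y] B_carrier[OF b]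
  have cG: "?c \<in> carrier G" using G by simp
  \<comment> \<open>Applied to the inverses of \<open>x\<close> and \<open>y\<close>,
    \<open>main\<close> says that the inverses of \<open>y x\<close> and \<open>x y\<close>
    conjugate \<open>?c\<close> alike. Hence \<open>(x y) (y x)^-1\<close>, which is
    \<open>[x, y]\<close>, commutes with \<open>?c\<close>.\<close>
  have "?x \<otimes> (?y \<otimes> ?c \<otimes> y) \<otimes> x = ?y \<otimes> (?x \<otimes> ?c \<otimes> x) \<otimes> y"
    using main[of ?x ?y] x y subgroup.m_inv_closed[OF subA] subgroup.m_inv_closed[OF subB] G by simp
  hence eq: "inv (y \<otimes> x) \<otimes> ?c \<otimes> (y \<otimes> x) = inv (x \<otimes> y) \<otimes> ?c \<otimes> (x \<otimes> y)"
    using G cG by (simp add: m_assoc inv_mult_group)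
  have "(x \<otimes> y) \<otimes> (inv (y \<otimes> x) \<otimes> ?c \<otimes> (y \<otimes> x)) \<otimes> inv (y \<otimes> x)
      = (x \<otimes> y) \<otimes> (inv (x \<otimes> y) \<otimes> ?c \<otimes> (x \<otimes> y)) \<otimes> inv (y \<otimes> x)"
    unfolding eq ..
  hence "(x \<otimes> y) \<otimes> inv (y \<otimes> x) \<otimes> ?c = ?c \<otimes> ((x \<otimes> y) \<otimes> inv (y \<otimes> x))"
    using G cG by (simp only: m_assoc mult_inv_cancel r_inv r_one m_closed inv_closed)
  moreover have "(x \<otimes> y) \<otimes> inv (y \<otimes> x) = commutator x y"
    using G by (simp add: m_assoc inv_mult_group)
  ultimately show ?thesis by simp
qed

text \<open>Ito's theorem. The commutators \<open>[a, b]\<close> with \<open>a\<close> in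
  \<open>A\<close> and \<open>b\<close> in \<open>B\<close> commute pairwise, and the set
  \<open>C\<close> of them is closed under conjugation. So \<open>C\<close> generates an abelian
  normal subgroup \<open>W\<close>, and expanding both entries along \<open>A B\<close> puts every
  commutator into \<open>W\<close>.\<close>

theorem derived_abelian:
  assumes "x \<in> derived G (carrier G)" "y \<in> derived G (carrier G)"
  shows "x \<otimes> y = y \<otimes> x"
proof -
  define C where "C = {commutator a b |a b. a \<in> A \<and> b \<in> B}"
  have CG: "C \<subseteq> carrier G" using A_carrier B_carrier by (auto simp: C_def)
  have memC: "commutator a b \<in> C" if "a \<in> A" "b \<in> B" for a b using that by (auto simp: C_def)
  have conjA: "u \<otimes> c \<otimes> inv u \<in> C" if u: "u \<in> A" and c: "c \<in> C" for u c
  proof -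
    obtain a b where ab: "a \<in> A" "b \<in> B" "c = commutator a b" using c by (auto simp: C_def)
    note G = A_carrier[OF u] B_carrier[OF ab(2)]
    obtain b' a' where 1: "b' \<in> B" "a' \<in> A" "u \<otimes> b \<otimes> inv u = b' \<otimes> a'"
      using obtain_BA[of "u \<otimes> b \<otimes> inv u"] G by auto
    show ?thesis
      using conj_A_commutator[OF u ab(1) G(2)] 1
        commutator_drop_right[OF ab(1) B_carrier[OF 1(1)] 1(2)] memC ab by simp
  qed
  have conjB: "u \<otimes> c \<otimes> inv u \<in> C" if u: "u \<in> B" and c: "c \<in> C" for u c
  proof -
    obtain a b where ab: "a \<in> A" "b \<in> B" "c = commutator a b" using c by (auto simp: C_def)
    note G = B_carrier[OF u] A_carrier[OF ab(1)]
    obtain a' b' where 1: "a' \<in> A" "b' \<in> B" "u \<otimes> a \<otimes> inv u = a' \<otimes> b'"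
      using obtain_AB[of "u \<otimes> a \<otimes> inv u"] G by auto
    show ?thesis
      using conj_B_commutator[OF u G(2) ab(2)] 1
        commutator_drop_left[OF A_carrier[OF 1(1)] 1(2) ab(2)] memC ab by simp
  qed
  define W where "W = generate G C"
  have W: "W \<lhd> G"
    unfolding W_def
  proof (rule normal_generateI[OF CG])
    fix c g assume c: "c \<in> C" and g: "g \<in> carrier G"
    obtain a b where ab: "a \<in> A" "b \<in> B" "g = a \<otimes> b" using obtain_AB[OF g] .
    have "g \<otimes> c \<otimes> inv g = a \<otimes> (b \<otimes> c \<otimes> inv b) \<otimes> inv a"
      using ab A_carrier B_carrier c CG by (auto simp: m_assoc inv_mult_group)
    thus "g \<otimes> c \<otimes> inv g \<in> C" using conjA[OF ab(1) conjB[OF ab(2) c]] by simp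
  qed
  note subW = normal_imp_subgroup[OF W]
  have "derived_set G (carrier G) \<subseteq> W"
  proof
    fix z assume "z \<in> derived_set G (carrier G)"
    then obtain g h where gh: "g \<in> carrier G" "h \<in> carrier G" "z = commutator g h" by auto
    obtain a b where ab: "a \<in> A" "b \<in> B" "g = a \<otimes> b" using obtain_AB[OF gh(1)] .
    obtain c d where cd: "c \<in> A" "d \<in> B" "h = c \<otimes> d" using obtain_AB[OF gh(2)] .
    note G = A_carrier[OF ab(1)] B_carrier[OF ab(2)] A_carrier[OF cd(1)] B_carrier[OF cd(2)]
    have AB: "commutator u v \<in> W" if "u \<in> A" "v \<in> B" for u v
      using memC[OF that] by (auto simp: W_def intro: generate.incl)
    have triv: "commutator u v \<in> W" if "u \<in> carrier G" "v \<in> carrier G" "u \<otimes> v = v \<otimes> u" for u v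
      using that subgroup.one_closed[OF subW] by (simp add: m_assoc mult_inv_cancel)
    \<comment> \<open>With \<open>h = c d\<close>, the commutator \<open>[c, a]\<close> is trivial
      and \<open>[d, a]\<close> is the inverse of the generator \<open>[a, d]\<close>.\<close>
    have "commutator h a \<in> W"
      unfolding cd(3)
      by (rule commutator_mult_mem[OF W G(3,4,1) triv commutator_swap_mem[OF subW G(1,4)]])
        (use G ab cd commA AB in auto)
    hence ah: "commutator a h \<in> W" using commutator_swap_mem[OF subW] gh G by blast
    have "commutator h b \<in> W"
      unfolding cd(3)
      by (rule commutator_mult_mem[OF W G(3,4,2) AB triv]) (use G ab cd commB in auto)
    hence bh: "commutator b h \<in> W" using commutator_swap_mem[OF subW] gh G by blast
    show "z \<in> W"
      using commutator_mult_mem[OF W G(1,2) gh(2) ah bh] gh ab by simp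
  qed
  hence "derived G (carrier G) \<subseteq> W"
    unfolding derived_def by (rule generate_subgroup_incl[OF _ subW])
  moreover have "u \<otimes> v = v \<otimes> u" if "u \<in> C" "v \<in> C" for u v
    using that commutators_commute by (auto simp: C_def)
  ultimately show ?thesis
    using generate_commute[OF CG] assms unfolding W_def by blast
qed

end

subsection \<open>Invariant normal subgroups\<close>

lemma (in group) image_centralizer_in:
  assumes "\<phi> \<in> iso G G" "H \<subseteq> carrier G" "K \<subseteq> carrier G" "\<phi> ` H = H" "\<phi> ` K = K"
  shows "\<phi> ` centralizer_in G H K \<subseteq> centralizer_in G H K"
proof
  fix z assume "z \<in> \<phi> ` centralizer_in G H K"
  then obtain x where x: "x \<in> H" "z = \<phi> x" and comm: "\<And>y. y \<in> K \<Longrightarrow> x \<otimes> y = y \<otimes> x"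
    by (auto simp: centralizer_in_def)
  have hom: "\<phi> \<in> hom G G" using assms(1) by (simp add: iso_def)
  have "z \<otimes> y = y \<otimes> z" if y: "y \<in> K" for y
  proof -
    obtain y' where y': "y' \<in> K" "y = \<phi> y'" using y assms(5) by blast
    have "x \<in> carrier G" "y' \<in> carrier G" using x y' assms(2,3) by auto
    hence "z \<otimes> y = \<phi> (x \<otimes> y')" "y \<otimes> z = \<phi> (y' \<otimes> x)"
      using hom_mult[OF hom] x(2) y'(2) by auto
    thus ?thesis using comm[OF y'(1)] by simp
  qed
  moreover have "z \<in> H" using x assms(4) by blast
  ultimately show "z \<in> centralizer_in G H K" by (intro centralizer_inI)
qed

lemma (in group) iso_image_eq:
  assumes "finite (carrier G)" "\<phi> \<in> iso G G" "H \<subseteq> carrier G" "\<phi> ` H \<subseteq> H"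
  shows "\<phi> ` H = H"
proof -
  have "inj_on \<phi> H" using assms(2,3) by (auto simp: iso_def bij_betw_def intro: inj_on_subset)
  thus ?thesis using endo_inj_surj[OF _ assms(4)] assms(1,3) finite_subset by blast
qed

context abelian_factorization
begin

text \<open>Preservation is asked of \<open>A\<close> alone: the maps \<open>lambda a\<close> of the
  brace preserve the left ideal \<open>A1\<close>, but they may move \<open>A2\<close>.\<close>

definition invariant :: "'a set \<Rightarrow> bool"
  where "invariant N \<longleftrightarrow> (\<forall>\<phi>\<in>iso G G. \<phi> ` A = A \<longrightarrow> \<phi> ` N \<subseteq> N)"

text \<open>\<open>?M\<close> is the core of \<open>A\<close>, collected elementwise. It contains
  \<open>N\<close>, hence is nontrivial, and it is determined by \<open>G\<close> and
  \<open>A\<close>, hence invariant.\<close>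

lemma normal_core:
  assumes N: "N \<lhd> G" "N \<noteq> {\<one>}" "N \<subseteq> A"
  obtains M where "M \<lhd> G" "M \<noteq> {\<one>}" "M \<subseteq> A" "invariant M"
proof -
  let ?M = "{x \<in> A. \<forall>g\<in>carrier G. g \<otimes> x \<otimes> inv g \<in> A}"
  have MI: "x \<in> ?M" if "x \<in> carrier G" "\<And>g. g \<in> carrier G \<Longrightarrow> g \<otimes> x \<otimes> inv g \<in> A" for x
    using that(2)[OF one_closed] that by auto
  have M: "?M \<lhd> G"
  proof (rule normal_invI)
    show "subgroup ?M G"
    proof (rule subgroupI)
      show "?M \<subseteq> carrier G" using A_carrier by auto
      show "?M \<noteq> {}" using subgroup.one_closed[OF subA] by (auto intro!: exI[of _ \<one>])
    next
      fix x assume x: "x \<in> ?M"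
      hence xG: "x \<in> carrier G" using A_carrier by auto
      show "inv x \<in> ?M"
      proof (rule MI)
        show "inv x \<in> carrier G" using xG by simp
        fix g assume g: "g \<in> carrier G"
        have "g \<otimes> inv x \<otimes> inv g = inv (g \<otimes> x \<otimes> inv g)"
          using g xG by (simp add: inv_mult_group m_assoc)
        thus "g \<otimes> inv x \<otimes> inv g \<in> A" using x g subgroup.m_inv_closed[OF subA] by auto
      qed
    next
      fix x y assume xy: "x \<in> ?M" "y \<in> ?M"
      hence G: "x \<in> carrier G" "y \<in> carrier G" using A_carrier by auto
      show "x \<otimes> y \<in> ?M"
        using xy G conj_mult[OF _ G] subgroup.m_closed[OF subA] by auto
    qed
    fix g x assume g: "g \<in> carrier G" and x: "x \<in> ?M"
    hence xG: "x \<in> carrier G" using A_carrier by auto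
    show "g \<otimes> x \<otimes> inv g \<in> ?M"
    proof (rule MI)
      show "g \<otimes> x \<otimes> inv g \<in> carrier G" using g xG by simp
      fix h assume h: "h \<in> carrier G"
      have "h \<otimes> (g \<otimes> x \<otimes> inv g) \<otimes> inv h = (h \<otimes> g) \<otimes> x \<otimes> inv (h \<otimes> g)"
        using g h xG by (simp add: inv_mult_group m_assoc)
      thus "h \<otimes> (g \<otimes> x \<otimes> inv g) \<otimes> inv h \<in> A" using x g h by auto
    qed
  qed
  have "N \<subseteq> ?M" using N normal_invE(2)[OF N(1)] by auto
  hence "?M \<noteq> {\<one>}"
    using N(2) subgroup.one_closed[OF normal_imp_subgroup[OF N(1)]] by blast
  moreover have "invariant ?M"
    unfolding invariant_def
  proof (intro ballI impI subsetI)
    fix \<phi> z assume \<phi>: "\<phi> \<in> iso G G" "\<phi> ` A = A" and "z \<in> \<phi> ` ?M"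
    then obtain x where x: "x \<in> ?M" "z = \<phi> x" by auto
    interpret \<phi>: group_hom G G \<phi>
      using \<phi>(1) by (simp add: group_hom_def group_hom_axioms_def iso_def is_group)
    have xG: "x \<in> carrier G" using x A_carrier by auto
    show "z \<in> ?M"
    proof (rule MI)
      show "z \<in> carrier G" using x xG by simp
      fix g assume "g \<in> carrier G"
      then obtain h where h: "h \<in> carrier G" "g = \<phi> h"
        using \<phi>(1) by (auto simp: iso_def bij_betw_def)
      have "g \<otimes> z \<otimes> inv g = \<phi> (h \<otimes> x \<otimes> inv h)" using h x xG by simp
      thus "g \<otimes> z \<otimes> inv g \<in> A" using \<phi>(2) x h by auto
    qed
  qed
  ultimately show ?thesis using that[OF M] by auto
qed

end

section \<open>Factorizations in which the core of \<open>A\<close> is trivial\<close>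

locale core_free_factorization = abelian_factorization +
  assumes fin: "finite (carrier G)"
    and core_free: "\<lbrakk> N \<lhd> G; N \<subseteq> A \<rbrakk> \<Longrightarrow> N = {\<one>}"
begin

abbreviation center :: "'a set"
  where "center \<equiv> centralizer_in G (carrier G) (carrier G)"

lemma centerI:
  assumes x: "x \<in> carrier G" and A: "\<And>a. a \<in> A \<Longrightarrow> x \<otimes> a = a \<otimes> x"
    and B: "\<And>b. b \<in> B \<Longrightarrow> x \<otimes> b = b \<otimes> x"
  shows "x \<in> center"
proof -
  have "x \<otimes> g = g \<otimes> x" if g: "g \<in> carrier G" for g
  proof -
    obtain a b where ab: "a \<in> A" "b \<in> B" "g = a \<otimes> b" using obtain_AB[OF g] .
    have "x \<otimes> (a \<otimes> b) = a \<otimes> (x \<otimes> b)"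
      using A[OF ab(1)] x A_carrier[OF ab(1)] B_carrier[OF ab(2)] by (simp flip: m_assoc)
    also have "\<dots> = a \<otimes> b \<otimes> x"
      using B[OF ab(2)] x A_carrier[OF ab(1)] B_carrier[OF ab(2)] by (simp add: m_assoc)
    finally show ?thesis using ab(3) by simp
  qed
  thus ?thesis using x by (intro centralizer_inI)
qed

lemma normal_center: "center \<lhd> G"
  using normal_centralizer_in[OF normal_self normal_self] .

text \<open>A group of central elements is normal, so the part of the center in \<open>A\<close>
  falls under \<open>core_free\<close>.\<close>

lemma center_Int_A:
  assumes "x \<in> center" "x \<in> A"
  shows "x = \<one>"
proof -
  have sub: "subgroup (A \<inter> center) G"
    using subgroups_Inter_pair[OF subA normal_imp_subgroup[OF normal_center]] .
  have "A \<inter> center \<lhd> G"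
  proof (rule normal_invI[OF sub])
    fix g x assume g: "g \<in> carrier G" and x: "x \<in> A \<inter> center"
    hence "g \<otimes> x = x \<otimes> g" "x \<in> carrier G" using A_carrier centralizer_inD(2)[of x] by fastforce+
    thus "g \<otimes> x \<otimes> inv g \<in> A \<inter> center" using g x by (simp add: m_assoc)
  qed
  thus ?thesis using core_free[of "A \<inter> center"] assms by blast
qed

text \<open>An element of both factors commutes with \<open>A\<close> and with \<open>B\<close>, so
  it is central and lies in \<open>A\<close>.\<close>

lemma A_Int_B: "A \<inter> B = {\<one>}"
proof -
  have "x = \<one>" if "x \<in> A" "x \<in> B" for x
    using center_Int_A[OF centerI] that commA commB A_carrier by blast
  thus ?thesis using subgroup.one_closed[OF subA] subgroup.one_closed[OF subB] by blast
qed

text \<open>For a central \<open>z = a b\<close>, the factor \<open>a\<close> commutes with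
  \<open>B\<close> because \<open>z\<close> and \<open>b\<close> do. As it also commutes with
  \<open>A\<close>, it is central and therefore trivial.\<close>

lemma center_subset_B: "center \<subseteq> B"
proof
  fix z assume z: "z \<in> center"
  hence zG: "z \<in> carrier G" and comm: "\<And>g. g \<in> carrier G \<Longrightarrow> z \<otimes> g = g \<otimes> z"
    using centralizer_inD[OF z] by blast+
  obtain a b where ab: "a \<in> A" "b \<in> B" "z = a \<otimes> b" using obtain_AB[OF zG] .
  note G = A_carrier[OF ab(1)] B_carrier[OF ab(2)]
  have "a \<otimes> y = y \<otimes> a" if y: "y \<in> B" for y
  proof -
    have yG: "y \<in> carrier G" using y B_carrier by simp
    have "a \<otimes> y \<otimes> b = a \<otimes> b \<otimes> y" using G yG commB[OF y ab(2)] by (simp add: m_assoc)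
    also have "\<dots> = y \<otimes> a \<otimes> b" using comm[OF yG] ab G yG by (simp add: m_assoc)
    finally show ?thesis using G yG by simp
  qed
  hence "a \<in> center" using centerI[OF G(1)] commA[OF ab(1)] by blast
  hence "a = \<one>" using center_Int_A ab(1) by blast
  thus "z \<in> B" using ab G by simp
qed

text \<open>If \<open>x = a b\<close> centralizes \<open>A\<close>, then so does \<open>b\<close>;
  since \<open>b\<close> also commutes with \<open>B\<close>, it is central and therefore
  trivial.\<close>

lemma centralizer_A:
  assumes "center = {\<one>}" and x: "x \<in> carrier G" and comm: "\<And>a. a \<in> A \<Longrightarrow> x \<otimes> a = a \<otimes> x"
  shows "x \<in> A"
proof -
  obtain a b where ab: "a \<in> A" "b \<in> B" "x = a \<otimes> b" using obtain_AB[OF x] .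
  note G = A_carrier[OF ab(1)] B_carrier[OF ab(2)]
  have "b \<otimes> y = y \<otimes> b" if y: "y \<in> A" for y
  proof -
    have yG: "y \<in> carrier G" using y A_carrier by simp
    have "a \<otimes> (b \<otimes> y) = y \<otimes> (a \<otimes> b)" using comm[OF y] ab G yG by (simp add: m_assoc)
    also have "\<dots> = a \<otimes> (y \<otimes> b)" using commA[OF y ab(1)] G yG by (simp flip: m_assoc)
    finally show ?thesis using G yG by simp
  qed
  hence "b \<in> center" using centerI[OF G(2)] commB[OF ab(2)] by blast
  hence "b = \<one>" using assms(1) by simp
  thus ?thesis using ab G by simp
qed

text \<open>The centralizer \<open>?N\<close> of \<open>?D\<close> in \<open>A\<close> is normal,
  hence trivial. Indeed, a conjugate of an element of \<open>?N\<close> still centralizes the normal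
  subgroup \<open>?D\<close>, and it also centralizes \<open>A\<close>, so
  \<open>centralizer_A\<close> brings it back into \<open>A\<close>.\<close>

lemma centralizer_derived_Int_A:
  assumes cl: "center = {\<one>}" and x: "x \<in> A"
    and comm: "\<And>d. d \<in> derived G (carrier G) \<Longrightarrow> x \<otimes> d = d \<otimes> x"
  shows "x = \<one>"
proof -
  let ?D = "derived G (carrier G)"
  let ?N = "centralizer_in G A ?D"
  have D: "?D \<lhd> G" by (rule derived_self_is_normal)
  have DG: "?D \<subseteq> carrier G" using derived_in_carrier by blast
  have "?N \<lhd> G"
  proof (rule normal_invI)
    show "subgroup ?N G" using subgroup_centralizer_in[OF subA DG] .
    fix g x assume g: "g \<in> carrier G" and "x \<in> ?N"
    hence x: "x \<in> A" and xD: "\<And>d. d \<in> ?D \<Longrightarrow> x \<otimes> d = d \<otimes> x"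
      using centralizer_inD by fast+
    have xG: "x \<in> carrier G" using A_carrier[OF x] .
    let ?y = "g \<otimes> x \<otimes> inv g"
    have yD: "?y \<in> centralizer_in G (carrier G) ?D"
      using normal_invE(2)[OF normal_centralizer_in[OF normal_self D] g] centralizer_inI[OF xG xD]
      by blast
    have "?y \<in> A"
    proof (rule centralizer_A[OF cl])
      show "?y \<in> carrier G" using g xG by simp
      fix a assume a: "a \<in> A"
      have aG: "a \<in> carrier G" using A_carrier[OF a] .
      \<comment> \<open>\<open>?d\<close> is the commutator of \<open>inv g\<close> and
        \<open>a\<close>. Thus \<open>inv g \<otimes> a \<otimes> g\<close> equals
        \<open>?d \<otimes> a\<close>, and \<open>x\<close> commutes with both factors.\<close>
      let ?d = "inv g \<otimes> a \<otimes> inv (inv g) \<otimes> inv a"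
      have "?d \<in> ?D"
        unfolding derived_def by (rule generate.incl) (use g aG in blast)
      hence "x \<otimes> ?d = ?d \<otimes> x" by (rule xD)
      moreover have ad: "inv g \<otimes> a \<otimes> g = ?d \<otimes> a"
        using g aG by (simp add: m_assoc)
      moreover have "?d \<in> carrier G" using g aG by simp
      ultimately have "x \<otimes> (?d \<otimes> a) = ?d \<otimes> a \<otimes> x"
        using commA[OF x a] xG aG by (metis m_assoc)
      hence "x \<otimes> (inv g \<otimes> a \<otimes> g) = (inv g \<otimes> a \<otimes> g) \<otimes> x" unfolding ad .
      hence "g \<otimes> (x \<otimes> (inv g \<otimes> a \<otimes> g)) \<otimes> inv g = g \<otimes> ((inv g \<otimes> a \<otimes> g) \<otimes> x) \<otimes> inv g"
        by simp
      thus "?y \<otimes> a = a \<otimes> ?y" using g aG xG by (simp add: m_assoc mult_inv_cancel)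
    qed
    thus "?y \<in> ?N" using centralizer_inD(2)[OF yD] by (intro centralizer_inI)
  qed
  moreover have "?N \<subseteq> A" using centralizer_inD(1) by fast
  ultimately have "?N = {\<one>}" by (rule core_free)
  thus ?thesis using centralizer_inI[OF x comm] by blast
qed

end

section \<open>Largest normal \<open>p\<close>-subgroups inside a given subgroup\<close>

context group
begin

lemma conj_pow:
  fixes n :: nat
  assumes "g \<in> carrier G" "x \<in> carrier G"
  shows "(g \<otimes> x \<otimes> inv g) [^] n = g \<otimes> x [^] n \<otimes> inv g"
proof (induction n)
  case 0
  show ?case using assms by simp
next
  case (Suc n)
  thus ?case using conj_mult[of g "x [^] n" x] assms by simp
qed

text \<open>Take \<open>T\<close> of maximal order. For a competitor \<open>N\<close>, the product
  \<open>T <#> N\<close> is again a normal \<open>p\<close>-subgroup inside \<open>U\<close>, since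
  its order divides the product of the two orders; maximality forces it to equal
  \<open>T\<close>.\<close>

lemma exists_largest_normal_p_subgroup:
  assumes fin: "finite (carrier G)" and p: "Factorial_Ring.prime p" and U: "subgroup U G"
  obtains T n where "T \<lhd> G" "T \<subseteq> U" "card T = p ^ n"
    and "\<And>N m. \<lbrakk> N \<lhd> G; N \<subseteq> U; card N = p ^ m \<rbrakk> \<Longrightarrow> N \<subseteq> T"
proof -
  define F where "F = {N. N \<lhd> G \<and> N \<subseteq> U \<and> (\<exists>m. card N = p ^ m)}"
  have "F \<subseteq> Pow (carrier G)"
    using normal_imp_subgroup subgroup.subset by (fastforce simp: F_def)
  hence finF: "finite F" using fin finite_subset by blast
  have "card {\<one>} = p ^ 0" by simp
  hence "{\<one>} \<in> F"
    unfolding F_def using one_is_normal subgroup.one_closed[OF U] by blast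
  hence "Max (card ` F) \<in> card ` F" using finF by (intro Max_in) auto
  then obtain T where T: "T \<in> F" "Max (card ` F) = card T" by blast
  have max: "card N \<le> card T" if "N \<in> F" for N
    unfolding T(2)[symmetric] using finF that by simp
  have T': "T \<lhd> G" "T \<subseteq> U" using T(1) by (auto simp: F_def)
  obtain n where n: "card T = p ^ n" using T(1) by (auto simp: F_def)
  have "N \<subseteq> T" if N: "N \<lhd> G" "N \<subseteq> U" "card N = p ^ m" for N m
  proof -
    note subT = normal_imp_subgroup[OF T'(1)] and subN = normal_imp_subgroup[OF N(1)]
    let ?M = "T <#> N"
    have M: "?M \<lhd> G" using normal_set_mult[OF T'(1) N(1)] .
    have "?M \<subseteq> U"
      using T'(2) N(2) subgroup.m_closed[OF U] by (force simp: set_mult_def)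
    moreover have "card ?M dvd p ^ (n + m)"
      using card_set_mult[OF fin subT subN] n N(3) by (metis dvd_triv_left power_add)
    ultimately have "?M \<in> F"
      using M divides_primepow_nat[OF p] by (auto simp: F_def)
    hence le: "card ?M \<le> card T" by (rule max)
    have finM: "finite ?M"
      using fin finite_subset subgroup.subset[OF normal_imp_subgroup[OF M]] by blast
    have TM: "T \<subseteq> ?M"
    proof
      fix t assume t: "t \<in> T"
      hence "t = t \<otimes> \<one>" using subgroup.mem_carrier[OF subT] by simp
      thus "t \<in> ?M" using t subgroup.one_closed[OF subN] unfolding set_mult_def by blast
    qed
    have "N \<subseteq> ?M"
    proof
      fix t assume t: "t \<in> N"
      hence "t = \<one> \<otimes> t" using subgroup.mem_carrier[OF subN] by simp
      thus "t \<in> ?M" using t subgroup.one_closed[OF subT] unfolding set_mult_def by blast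
    qed
    thus ?thesis using card_seteq[OF finM TM le] by simp
  qed
  thus ?thesis using that T' n by blast
qed

end

section \<open>The factorizer of a normal subgroup\<close>

context abelian_factorization
begin

text \<open>Write \<open>a = b m\<close> and \<open>g = c d\<close>. Conjugation by \<open>d\<close>
  fixes \<open>b\<close>, so it changes \<open>a\<close> only by an element of \<open>P\<close>;
  conjugation by \<open>c\<close> fixes \<open>a\<close> and preserves \<open>P\<close>.\<close>

lemma conj_factorizer:
  assumes P: "P \<lhd> G" and a: "a \<in> A" "a \<in> B <#> P" and g: "g \<in> carrier G"
  obtains m where "m \<in> P" "g \<otimes> a \<otimes> inv g = a \<otimes> m"
proof -
  note subP = normal_imp_subgroup[OF P]
  obtain b m where bm: "b \<in> B" "m \<in> P" "a = b \<otimes> m" using a(2) by (auto simp: set_mult_def)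
  obtain c d where cd: "c \<in> A" "d \<in> B" "g = c \<otimes> d" using obtain_AB[OF g] .
  have G: "a \<in> carrier G" "b \<in> carrier G" "m \<in> carrier G" "c \<in> carrier G" "d \<in> carrier G"
    using a bm cd A_carrier B_carrier subgroup.mem_carrier[OF subP] by auto
  define m1 where "m1 = inv m \<otimes> (d \<otimes> m \<otimes> inv d)"
  have m1: "m1 \<in> P"
    unfolding m1_def
    using subgroup.m_closed[OF subP] subgroup.m_inv_closed[OF subP] normal_invE(2)[OF P G(5)] bm(2)
    by blast
  have m1G: "m1 \<in> carrier G" using subgroup.mem_carrier[OF subP m1] .
  have "d \<otimes> a \<otimes> inv d = d \<otimes> b \<otimes> m \<otimes> inv d" using bm G by (simp add: m_assoc)
  also have "\<dots> = b \<otimes> d \<otimes> m \<otimes> inv d" using commB[OF cd(2) bm(1)] by simp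
  also have "\<dots> = a \<otimes> m1"
    unfolding m1_def using bm(3) G by (simp add: m_assoc mult_inv_cancel)
  finally have da: "d \<otimes> a \<otimes> inv d = a \<otimes> m1" .
  have ca: "c \<otimes> a \<otimes> inv c = a"
    using commA[OF cd(1) a(1)] G by (simp add: m_assoc)
  have "g \<otimes> a \<otimes> inv g = c \<otimes> (d \<otimes> a \<otimes> inv d) \<otimes> inv c"
    using cd(3) G by (simp add: m_assoc inv_mult_group)
  also have "\<dots> = (c \<otimes> a \<otimes> inv c) \<otimes> (c \<otimes> m1 \<otimes> inv c)"
    unfolding da using conj_mult G m1G by blast
  also have "\<dots> = a \<otimes> (c \<otimes> m1 \<otimes> inv c)" unfolding ca ..
  finally show ?thesis using that normal_invE(2)[OF P G(4) m1] by blast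
qed

text \<open>By Dedekind's law this subgroup is the intersection of \<open>A <#> P\<close> and
  \<open>B <#> P\<close>. It is normal because conjugation moves elements of
  \<open>A \<inter> (B <#> P)\<close> only within their cosets of \<open>P\<close>.\<close>

lemma normal_factorizer:
  assumes P: "P \<lhd> G"
  shows "(A \<inter> (B <#> P)) <#> P \<lhd> G"
proof (rule normal_invI)
  note subP = normal_imp_subgroup[OF P]
  let ?C = "A \<inter> (B <#> P)"
  have subC: "subgroup ?C G"
    using subgroups_Inter_pair[OF subA set_mult_subgroup_right_normal[OF subB P]] .
  show "subgroup (?C <#> P) G" using set_mult_subgroup_right_normal[OF subC P] .
  fix g x assume g: "g \<in> carrier G" and "x \<in> ?C <#> P"
  then obtain a m where am: "a \<in> A" "a \<in> B <#> P" "m \<in> P" "x = a \<otimes> m"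
    unfolding set_mult_def[of G ?C] by blast
  obtain m' where m': "m' \<in> P" "g \<otimes> a \<otimes> inv g = a \<otimes> m'"
    using conj_factorizer[OF P am(1,2) g] .
  have m'': "g \<otimes> m \<otimes> inv g \<in> P" using normal_invE(2)[OF P g am(3)] .
  have G: "a \<in> carrier G" "m \<in> carrier G" "m' \<in> carrier G"
    using am m' A_carrier subgroup.mem_carrier[OF subP] by auto
  have "g \<otimes> x \<otimes> inv g = (a \<otimes> m') \<otimes> (g \<otimes> m \<otimes> inv g)"
    unfolding am(4) conj_mult[OF g G(1,2)] m'(2) ..
  also have "\<dots> = a \<otimes> (m' \<otimes> (g \<otimes> m \<otimes> inv g))" using G g by (simp add: m_assoc)
  finally show "g \<otimes> x \<otimes> inv g \<in> ?C <#> P"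
    using am(1,2) subgroup.m_closed[OF subP m'(1) m''] unfolding set_mult_def[of G ?C] by blast
qed

text \<open>This makes the factorizer a \<open>p\<close>-group whenever \<open>P\<close> is one. By
  Dedekind's law \<open>?U = ?C <#> B\<close> with \<open>?C \<inter> B\<close> trivial; comparing
  this with the order of \<open>B <#> P\<close> shows that \<open>card ?C\<close> divides
  \<open>card P\<close>.\<close>

lemma card_factorizer_dvd:
  assumes fin: "finite (carrier G)" and AB: "A \<inter> B = {\<one>}" and P: "P \<lhd> G"
  shows "card ((A \<inter> (B <#> P)) <#> P) dvd card P * card P"
proof -
  note subP = normal_imp_subgroup[OF P]
  let ?U = "B <#> P" and ?C = "A \<inter> (B <#> P)"
  have subU: "subgroup ?U G" using set_mult_subgroup_right_normal[OF subB P] .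
  have subC: "subgroup ?C G" using subgroups_Inter_pair[OF subA subU] .
  have BU: "B \<subseteq> ?U"
  proof
    fix b assume b: "b \<in> B"
    hence "b = b \<otimes> \<one>" using B_carrier by simp
    thus "b \<in> ?U" using b subgroup.one_closed[OF subP] unfolding set_mult_def by blast
  qed
  have "?C <#> B = ?U"
  proof (intro equalityI subsetI)
    fix x assume "x \<in> ?C <#> B"
    then obtain c b where "c \<in> ?C" "b \<in> B" "x = c \<otimes> b" unfolding set_mult_def[of G ?C] by blast
    thus "x \<in> ?U" using BU subgroup.m_closed[OF subU] by blast
  next
    fix x assume x: "x \<in> ?U"
    hence xG: "x \<in> carrier G" using subgroup.mem_carrier[OF subU] by blast
    obtain a b where ab: "a \<in> A" "b \<in> B" "x = a \<otimes> b" using obtain_AB[OF xG] .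
    have "a = x \<otimes> inv b" using ab A_carrier B_carrier by (simp add: m_assoc)
    moreover have "inv b \<in> ?U" using ab BU subgroup.m_inv_closed[OF subU] by blast
    ultimately have "a \<in> ?U" using x subgroup.m_closed[OF subU] by blast
    thus "x \<in> ?C <#> B" using ab unfolding set_mult_def[of G ?C] by blast
  qed
  moreover have "?C \<inter> B = {\<one>}" using AB subgroup.one_closed[OF subC] by blast
  ultimately have "card ?U = card ?C * card B"
    using card_set_mult[OF fin subC subB] by simp
  moreover have "card ?U * card (B \<inter> P) = card B * card P"
    using card_set_mult[OF fin subB subP] .
  moreover have "card B > 0" using subgroup.finite_imp_card_positive[OF subB fin] .
  ultimately have "card ?C * card (B \<inter> P) = card P"
    by (simp add: mult.assoc mult.left_commute)
  hence "card ?C dvd card P" by (metis dvd_triv_left)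
  moreover have "card (?C <#> P) dvd card ?C * card P"
    using card_set_mult[OF fin subC subP] by (metis dvd_triv_left)
  ultimately show ?thesis by (meson dvd_trans mult_dvd_mono dvd_refl)
qed

end

section \<open>The core-free case with trivial center\<close>

context core_free_factorization
begin

lemma derived_nontrivial:
  assumes cl: "center = {\<one>}" and ne: "carrier G \<noteq> {\<one>}"
  shows "derived G (carrier G) \<noteq> {\<one>}"
proof
  assume D: "derived G (carrier G) = {\<one>}"
  have "x \<otimes> y = y \<otimes> x" if xy: "x \<in> carrier G" "y \<in> carrier G" for x y
  proof -
    have "commutator x y \<in> derived G (carrier G)"
      unfolding derived_def by (rule generate.incl) (use xy in blast)
    hence "commutator x y \<otimes> (y \<otimes> x) = y \<otimes> x" using D xy by simp
    moreover have "commutator x y \<otimes> (y \<otimes> x) = x \<otimes> y"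
      using xy by (simp add: m_assoc mult_inv_cancel)
    ultimately show ?thesis by simp
  qed
  hence "x \<in> center" if "x \<in> carrier G" for x using that by (intro centralizer_inI)
  hence "carrier G \<subseteq> center" by blast
  thus False using cl ne one_closed by blast
qed

text \<open>First, the derived subgroup centralizes the center \<open>?Z\<close> of
  \<open>T\<close>. For \<open>z = a b\<close> in \<open>?Z\<close> with both factors in
  \<open>T\<close>, the factorization of \<open>T\<close> shows that \<open>a\<close> lies in
  \<open>?Z\<close> too; so \<open>a\<close> is an element of \<open>A\<close> that centralizes the
  derived subgroup, hence trivial. In the application \<open>q\<close> is a power of
  \<open>p\<close>, \<open>q'\<close> is the \<open>p\<close>-part of the order of the derived
  subgroup and \<open>m\<close> the remaining factor.\<close>

lemma center_subset_B_of_factorized: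
  fixes m :: nat
  assumes cl: "center = {\<one>}" and T: "T \<lhd> G" "card T = q"
    and PT: "\<And>d. d \<in> derived G (carrier G) \<Longrightarrow> d [^] m \<in> T"
    and exp: "\<And>d. d \<in> derived G (carrier G) \<Longrightarrow> d [^] (q' * m) = \<one>"
    and cop: "coprime q m" "coprime q' m"
    and fact: "T \<subseteq> (T \<inter> A) <#> (T \<inter> B)"
  shows "centralizer_in G T T \<subseteq> B"
proof
  let ?D = "derived G (carrier G)" and ?Z = "centralizer_in G T T"
  note subT = normal_imp_subgroup[OF T(1)]
  have D: "?D \<lhd> G" by (rule derived_self_is_normal)
  note subD = normal_imp_subgroup[OF D]
  have DG: "d \<in> carrier G" if "d \<in> ?D" for d using subgroup.mem_carrier[OF subD that] .
  have TG: "t \<in> carrier G" if "t \<in> T" for t using subgroup.mem_carrier[OF subT that] .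
  have D_comm: "d \<otimes> z = z \<otimes> d" if d: "d \<in> ?D" and z: "z \<in> ?Z" for d z
  proof -
    let ?C = "centralizer_in G (carrier G) {z}"
    have zT: "z \<in> T" using centralizer_inD(1)[OF z] .
    have zG: "z \<in> carrier G" using TG[OF zT] .
    have subC: "subgroup ?C G" using subgroup_centralizer_in[OF subgroup_self] zG by simp
    have dG: "d \<in> carrier G" using DG[OF d] .
    have "d [^] m \<otimes> z = z \<otimes> d [^] m" using centralizer_inD(2)[OF z PT[OF d]] by simp
    hence 1: "d [^] m \<in> ?C" using dG by (intro centralizer_inI) auto
    \<comment> \<open>The power \<open>?y\<close> is killed by \<open>m\<close>. The commutator
      \<open>?w\<close> of \<open>z\<close> and \<open>?y\<close> is a product of two such elements
      of the abelian group \<open>?D\<close>, so it is killed by \<open>m\<close>; it lies in the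
      normal subgroup \<open>T\<close>, so it is also killed by \<open>q\<close>.\<close>
    let ?y = "d [^] q'"
    have y: "?y \<in> ?D" using subgroup_nat_pow_closed[OF subD d] .
    have yG: "?y \<in> carrier G" using dG by simp
    let ?w = "(z \<otimes> ?y \<otimes> inv z) \<otimes> inv ?y"
    have zy: "z \<otimes> ?y \<otimes> inv z \<in> ?D" using normal_invE(2)[OF D zG y] .
    have iy: "inv ?y \<in> ?D" using subgroup.m_inv_closed[OF subD y] .
    have ym: "?y [^] m = \<one>" using exp[OF d] dG by (simp add: nat_pow_pow)
    have "?w [^] m = (z \<otimes> ?y \<otimes> inv z) [^] m \<otimes> (inv ?y) [^] m"
      using pow_mult_distrib[OF derived_abelian[OF zy iy]] DG zy iy by blast
    also have "\<dots> = \<one>"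
      using conj_pow[OF zG yG] ym zG yG by (simp add: nat_pow_inv)
    finally have "?w [^] m = \<one>" .
    moreover have "?w \<in> T"
    proof -
      have "?w = z \<otimes> (?y \<otimes> inv z \<otimes> inv ?y)" using zG yG by (simp add: m_assoc)
      moreover have "?y \<otimes> inv z \<otimes> inv ?y \<in> T"
        using normal_invE(2)[OF T(1) yG subgroup.m_inv_closed[OF subT zT]] .
      ultimately show ?thesis using subgroup.m_closed[OF subT zT] by simp
    qed
    hence "?w [^] q = \<one>" using pow_card_subgroup[OF fin subT] T(2) by simp
    ultimately have "?w = \<one>"
      using coprime_pow_eq_one[of ?w q m] cop(1) zG yG by simp
    hence "z \<otimes> ?y \<otimes> inv z \<otimes> inv ?y \<otimes> (?y \<otimes> z) = ?y \<otimes> z" using zG yG by simp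
    moreover have "z \<otimes> ?y \<otimes> inv z \<otimes> inv ?y \<otimes> (?y \<otimes> z) = z \<otimes> ?y"
      using zG yG by (simp add: m_assoc mult_inv_cancel)
    ultimately have "?y \<otimes> z = z \<otimes> ?y" by simp
    hence 2: "?y \<in> ?C" using yG by (intro centralizer_inI) auto
    have "d \<in> ?C" using coprime_pow_mem[OF subC dG 2 1 cop(2)] .
    thus ?thesis using centralizer_inD(2) by fast
  qed
  fix z assume z: "z \<in> ?Z"
  have zT: "z \<in> T" using centralizer_inD(1)[OF z] .
  obtain a b where ab: "a \<in> T" "a \<in> A" "b \<in> T" "b \<in> B" "z = a \<otimes> b"
    using fact zT by (force simp: set_mult_def)
  note G = TG[OF ab(1)] TG[OF ab(3)]
  have "a \<otimes> t = t \<otimes> a" if t: "t \<in> T" for t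
  proof -
    obtain c d where cd: "c \<in> T" "c \<in> A" "d \<in> T" "d \<in> B" "t = c \<otimes> d"
      using fact t by (force simp: set_mult_def)
    note G' = TG[OF cd(1)] TG[OF cd(3)]
    have "a \<otimes> d \<otimes> b = a \<otimes> b \<otimes> d" using commB[OF cd(4) ab(4)] G G' by (simp add: m_assoc)
    also have "\<dots> = d \<otimes> (a \<otimes> b)" using centralizer_inD(2)[OF z cd(3)] ab(5) by simp
    also have "\<dots> = d \<otimes> a \<otimes> b" using G G' by (simp add: m_assoc)
    finally have ad: "a \<otimes> d = d \<otimes> a" using G G' by simp
    have "a \<otimes> t = c \<otimes> a \<otimes> d" using cd(5) commA[OF ab(2) cd(2)] G G' by (simp flip: m_assoc)
    also have "\<dots> = c \<otimes> (d \<otimes> a)" using ad G G' by (simp add: m_assoc)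
    finally show ?thesis using cd(5) G G' by (simp add: m_assoc)
  qed
  hence "a \<in> ?Z" using ab(1) by (intro centralizer_inI)
  hence "a = \<one>"
    using centralizer_derived_Int_A[OF cl ab(2)] D_comm by metis
  thus "z \<in> B" using ab(4,5) G by simp
qed

lemma exists_invariant_normal_in_B:
  assumes cl: "center = {\<one>}" and ne: "carrier G \<noteq> {\<one>}"
  obtains N where "N \<lhd> G" "N \<noteq> {\<one>}" "N \<subseteq> B" "invariant N"
proof -
  let ?D = "derived G (carrier G)"
  have D: "?D \<lhd> G" by (rule derived_self_is_normal)
  note subD = normal_imp_subgroup[OF D]
  have DG: "d \<in> carrier G" if "d \<in> ?D" for d using subgroup.mem_carrier[OF subD that] .
  have Dpos: "card ?D > 0" using subgroup.finite_imp_card_positive[OF subD fin] .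
  have "card ?D \<noteq> 1"
  proof
    assume "card ?D = 1"
    then obtain x where "?D = {x}" by (rule card_1_singletonE)
    thus False using derived_nontrivial[OF cl ne] subgroup.one_closed[OF subD] by simp
  qed
  then obtain p where p: "Factorial_Ring.prime p" "p dvd card ?D" using prime_factor_nat by blast
  define q where "q = p ^ multiplicity p (card ?D)"
  obtain m where m: "card ?D = q * m" using multiplicity_dvd unfolding q_def by (metis dvdE)
  have "\<not> p dvd m"
    using multiplicity_decompose[of "card ?D" p] Dpos p(1) m q_def
    by (metis less_irrefl nonzero_mult_div_cancel_left mult_eq_0_iff not_prime_unit)
  hence pm: "coprime p m" using p(1) prime_imp_coprime by blast
  \<comment> \<open>The Sylow \<open>p\<close>-subgroup of the abelian group \<open>?D\<close>,
    described by torsion so that conjugations and automorphisms visibly preserve it.\<close>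
  define P where "P = {x \<in> ?D. x [^] q = \<one>}"
  have P: "P \<lhd> G"
  proof (rule normal_invI)
    show "subgroup P G"
    proof (rule subgroupI)
      show "P \<subseteq> carrier G" using DG by (auto simp: P_def)
      show "P \<noteq> {}" using subgroup.one_closed[OF subD] by (auto simp: P_def)
    next
      fix x assume "x \<in> P"
      thus "inv x \<in> P"
        using subgroup.m_inv_closed[OF subD] DG by (auto simp: P_def nat_pow_inv)
    next
      fix x y assume xy: "x \<in> P" "y \<in> P"
      hence "(x \<otimes> y) [^] q = x [^] q \<otimes> y [^] q"
        using DG derived_abelian by (intro pow_mult_distrib) (auto simp: P_def)
      thus "x \<otimes> y \<in> P" using xy subgroup.m_closed[OF subD] by (auto simp: P_def)
    qed
    fix g x assume g: "g \<in> carrier G" and x: "x \<in> P"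
    thus "g \<otimes> x \<otimes> inv g \<in> P"
      using normal_invE(2)[OF D g] conj_pow[OF g DG] by (auto simp: P_def)
  qed
  note subP = normal_imp_subgroup[OF P]
  have PG: "x \<in> carrier G" if "x \<in> P" for x using subgroup.mem_carrier[OF subP that] .
  obtain k where k: "card P = p ^ k"
    using card_prime_power_of_torsion[OF fin subP p(1)] unfolding P_def q_def by blast
  have P_ne: "P \<noteq> {\<one>}"
  proof -
    obtain x where "x \<in> ?D" "x \<noteq> \<one>" "x [^] q = \<one>"
      using exists_element_of_prime_power_order[OF fin subD p] unfolding q_def .
    hence "x \<in> P" "x \<noteq> \<one>" by (auto simp: P_def)
    thus ?thesis by blast
  qed
  let ?U = "A <#> P"
  have subU: "subgroup ?U G" using set_mult_subgroup_right_normal[OF subA P] .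
  obtain T n where T: "T \<lhd> G" "T \<subseteq> ?U" "card T = p ^ n"
    and T_max: "\<And>N m. \<lbrakk> N \<lhd> G; N \<subseteq> ?U; card N = p ^ m \<rbrakk> \<Longrightarrow> N \<subseteq> T"
    using exists_largest_normal_p_subgroup[OF fin p(1) subU] by blast
  note subT = normal_imp_subgroup[OF T(1)]
  have "P \<subseteq> ?U"
  proof
    fix x assume x: "x \<in> P"
    hence "x = \<one> \<otimes> x" using PG by simp
    thus "x \<in> ?U" using x subgroup.one_closed[OF subA] unfolding set_mult_def by blast
  qed
  hence PT: "P \<subseteq> T" using T_max[OF P _ k] by blast
  let ?S = "(A \<inter> (B <#> P)) <#> P"
  \<comment> \<open>The factorizer \<open>?S\<close> of \<open>P\<close> is a normal
    \<open>p\<close>-subgroup inside \<open>?U\<close>, so the choice of \<open>T\<close> applies to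
    it.\<close>
  have ST: "?S \<subseteq> T"
  proof -
    have "card ?S dvd p ^ (k + k)"
      using card_factorizer_dvd[OF fin A_Int_B P] k by (simp add: power_add)
    then obtain j where "card ?S = p ^ j" using divides_primepow_nat[OF p(1)] by blast
    moreover have "?S \<subseteq> ?U" by (intro mono_set_mult) auto
    ultimately show ?thesis using T_max[OF normal_factorizer[OF P]] by blast
  qed
  \<comment> \<open>If \<open>b = a x\<close> with \<open>x\<close> in \<open>P\<close>, then
    \<open>a = b x^-1\<close> lies in \<open>A \<inter> (B <#> P)\<close>, hence \<open>b\<close> in
    \<open>?S\<close>.\<close>
  have BU: "b \<in> T" if b: "b \<in> B" "b \<in> ?U" for b
  proof -
    obtain a x where ax: "a \<in> A" "x \<in> P" "b = a \<otimes> x" using b(2) by (auto simp: set_mult_def)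
    have "a = b \<otimes> inv x" using ax A_carrier PG by (simp add: m_assoc)
    hence "a \<in> B <#> P"
      using b(1) subgroup.m_inv_closed[OF subP ax(2)] unfolding set_mult_def by blast
    hence "b \<in> ?S" using ax unfolding set_mult_def[of G "A \<inter> (B <#> P)"] by blast
    thus ?thesis using ST by blast
  qed
  \<comment> \<open>For \<open>t = a b\<close>, both \<open>a\<close> and \<open>t\<close> lie in
    \<open>?U\<close>, so \<open>b\<close> lies in \<open>?U\<close> and by \<open>BU\<close> in
    \<open>T\<close>; then so does \<open>a\<close>.\<close>
  have fact: "T \<subseteq> (T \<inter> A) <#> (T \<inter> B)"
  proof
    fix t assume t: "t \<in> T"
    have tG: "t \<in> carrier G" using subgroup.mem_carrier[OF subT t] .
    obtain a b where ab: "a \<in> A" "b \<in> B" "t = a \<otimes> b" using obtain_AB[OF tG] .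
    have G: "a \<in> carrier G" "b \<in> carrier G" using ab A_carrier B_carrier by auto
    have "inv a \<in> ?U"
    proof -
      have "inv a = inv a \<otimes> \<one>" using G by simp
      thus ?thesis using subgroup.m_inv_closed[OF subA ab(1)] subgroup.one_closed[OF subP]
        unfolding set_mult_def by blast
    qed
    moreover have "b = inv a \<otimes> t" using ab(3) G by (simp add: mult_inv_cancel)
    ultimately have "b \<in> ?U" using subgroup.m_closed[OF subU] t T(2) by blast
    hence bT: "b \<in> T" using BU ab(2) by blast
    have "a = t \<otimes> inv b" using ab(3) G by (simp add: m_assoc)
    hence "a \<in> T" using subgroup.m_closed[OF subT t] subgroup.m_inv_closed[OF subT bT] by simp
    thus "t \<in> (T \<inter> A) <#> (T \<inter> B)" using ab bT unfolding set_mult_def by blast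
  qed
  let ?Z = "centralizer_in G T T"
  have exp: "d [^] (q * m) = \<one>" if "d \<in> ?D" for d
    using pow_card_subgroup[OF fin subD that] m by simp
  have Dm: "d [^] m \<in> T" if d: "d \<in> ?D" for d
  proof -
    have "(d [^] m) [^] q = \<one>" using exp[OF d] DG[OF d] by (simp add: nat_pow_pow mult.commute)
    hence "d [^] m \<in> P" using subgroup_nat_pow_closed[OF subD d] by (simp add: P_def)
    thus ?thesis using PT by blast
  qed
  have "?Z \<subseteq> B"
    by (rule center_subset_B_of_factorized[OF cl T(1,3) Dm exp _ _ fact]) (use pm q_def in simp_all)
  moreover have "?Z \<lhd> G" using normal_centralizer_in[OF T(1) T(1)] .
  moreover have "?Z \<noteq> {\<one>}"
  proof -
    have "T \<noteq> {\<one>}" using PT P_ne subgroup.one_closed[OF subP] by blast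
    thus ?thesis using p_subgroup_center_nontrivial[OF p(1) subT T(3)] by blast
  qed
  moreover have "invariant ?Z"
    unfolding invariant_def
  proof (intro ballI impI)
    fix \<phi> assume \<phi>: "\<phi> \<in> iso G G" "\<phi> ` A = A"
    interpret \<phi>: group_hom G G \<phi>
      using \<phi>(1) by (simp add: group_hom_def group_hom_axioms_def iso_def is_group)
    have \<phi>G: "\<phi> ` carrier G = carrier G" using \<phi>(1) by (simp add: iso_def bij_betw_def)
    \<comment> \<open>The ingredients \<open>?D\<close>, \<open>P\<close> and \<open>?U\<close> of
      the construction are preserved in turn. So the image of \<open>T\<close> is a normal
      \<open>p\<close>-subgroup inside \<open>?U\<close>, lies in \<open>T\<close> by maximality and
      equals \<open>T\<close> by finiteness.\<close>
    have \<phi>D: "\<phi> ` ?D = ?D" using \<phi>.derived_img[of "carrier G"] \<phi>G by simp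
    have "\<phi> ` P \<subseteq> P"
    proof
      fix y assume "y \<in> \<phi> ` P"
      then obtain x where x: "x \<in> ?D" "x [^] q = \<one>" "y = \<phi> x" by (auto simp: P_def)
      have "y [^] q = \<one>" using \<phi>.hom_nat_pow[OF DG[OF x(1)], of q] x by simp
      thus "y \<in> P" using x \<phi>D by (auto simp: P_def)
    qed
    moreover have "\<phi> ` ?U \<subseteq> (\<phi> ` A) <#> (\<phi> ` P)"
      using A_carrier PG unfolding set_mult_def by fastforce
    ultimately have \<phi>U: "\<phi> ` ?U \<subseteq> ?U"
      using \<phi>(2) mono_set_mult[of "\<phi> ` A" A "\<phi> ` P" P G] by blast
    have "T \<subseteq> carrier G" using subgroup.subset[OF subT] .
    hence "inj_on \<phi> T" using \<phi>(1) by (auto simp: iso_def bij_betw_def intro: inj_on_subset)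
    hence "card (\<phi> ` T) = p ^ n" using T(3) by (simp add: card_image)
    moreover have "\<phi> ` T \<lhd> G" using iso_normal_subgroup[OF \<phi>(1) is_group is_group T(1)] .
    moreover have "\<phi> ` T \<subseteq> ?U" using \<phi>U T(2) by blast
    ultimately have "\<phi> ` T \<subseteq> T" using T_max by blast
    hence "\<phi> ` T = T" using iso_image_eq[OF fin \<phi>(1) \<open>T \<subseteq> carrier G\<close>] by blast
    thus "\<phi> ` ?Z \<subseteq> ?Z"
      using image_centralizer_in[OF \<phi>(1) \<open>T \<subseteq> carrier G\<close> \<open>T \<subseteq> carrier G\<close>] by blast
  qed
  ultimately show ?thesis using that P_ne by blast
qed

end

theorem (in abelian_factorization) exists_invariant_normal_subgroup:
  assumes fin: "finite (carrier G)" and ne: "carrier G \<noteq> {\<one>}"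
  obtains N where "N \<lhd> G" "N \<noteq> {\<one>}" "N \<subseteq> A \<or> N \<subseteq> B" "invariant N"
proof (cases "\<exists>N. N \<lhd> G \<and> N \<noteq> {\<one>} \<and> N \<subseteq> A")
  case True
  thus ?thesis using normal_core that by metis
next
  case False
  then interpret core_free_factorization G A B
    using fin by unfold_locales blast+
  have inv: "invariant center"
    unfolding invariant_def
  proof (intro ballI impI)
    fix \<phi> assume \<phi>: "\<phi> \<in> iso G G"
    hence "\<phi> ` carrier G = carrier G" by (simp add: iso_def bij_betw_def)
    thus "\<phi> ` center \<subseteq> center" using image_centralizer_in[OF \<phi>] by blast
  qed
  show ?thesis
  proof (cases "center = {\<one>}")
    case True
    thus ?thesis using exists_invariant_normal_in_B[OF _ ne] that by metis
  next
    case False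
    thus ?thesis using that[OF normal_center] center_subset_B inv by blast
  qed
qed

subsection \<open>Skew braces\<close>

context skew_brace
begin

text \<open>The rewrites state the facts about the additive group in the notation of the ring
  record.\<close>

sublocale add: group "add_monoid B"
  rewrites "carrier (add_monoid B) = carrier B"
    and "monoid.mult (add_monoid B) = ring.add B"
    and "one (add_monoid B) = \<zero>"
    and "m_inv (add_monoid B) = a_inv B"
  by (rule additive_group) (auto simp: a_inv_def)

sublocale mult: group B
  by (rule multiplicative_group)

definition lambda :: "'a \<Rightarrow> 'a \<Rightarrow> 'a"
  where "lambda a b = \<ominus> a \<oplus> a \<otimes> b"

text \<open>Skew distributivity for \<open>a (0 + 0)\<close> reads
  \<open>a 0 = a 0 - a + a 0\<close>; cancelling on the left gives the claim.\<close>

lemma mult_zero: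
  assumes a: "a \<in> carrier B"
  shows "a \<otimes> \<zero> = a"
proof -
  have G: "a \<otimes> \<zero> \<in> carrier B" using a by simp
  have "a \<otimes> \<zero> \<oplus> \<zero> = a \<otimes> (\<zero> \<oplus> \<zero>)" using G by simp
  also have "\<dots> = a \<otimes> \<zero> \<ominus> a \<oplus> a \<otimes> \<zero>" using a by (intro skew_distrib) simp_all
  also have "\<dots> = a \<otimes> \<zero> \<oplus> (\<ominus> a \<oplus> a \<otimes> \<zero>)" using a G by (simp add: a_minus_def add.m_assoc)
  finally have "\<ominus> a \<oplus> a \<otimes> \<zero> = \<zero>" using a G by (subst (asm) add.l_cancel) simp_all
  hence "a \<oplus> (\<ominus> a \<oplus> a \<otimes> \<zero>) = a" using a by simp
  thus ?thesis using add.mult_inv_cancel(1)[OF a G] by simp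
qed

lemma zero_eq_one: "\<zero> = \<one>"
  using mult_zero[of \<one>] by simp

lemma lambda_closed: "\<lbrakk> a \<in> carrier B; b \<in> carrier B \<rbrakk> \<Longrightarrow> lambda a b \<in> carrier B"
  by (simp add: lambda_def)

lemma mult_eq_add_lambda:
  "\<lbrakk> a \<in> carrier B; b \<in> carrier B \<rbrakk> \<Longrightarrow> a \<otimes> b = a \<oplus> lambda a b"
  by (simp add: lambda_def add.mult_inv_cancel)

lemma star_eq_lambda: "a \<star> b = lambda a b \<ominus> b"
  by (simp add: star_def lambda_def)

text \<open>Additivity is skew distributivity with \<open>- a\<close> put in front. The map is a
  multiplicative translation followed by an additive one, so undoing both gives the inverse.\<close>

lemma lambda_iso:
  assumes a: "a \<in> carrier B"
  shows "lambda a \<in> iso (add_monoid B) (add_monoid B)"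
proof (rule isoI)
  show "lambda a \<in> hom (add_monoid B) (add_monoid B)"
  proof (rule homI)
    fix x y assume "x \<in> carrier (add_monoid B)" "y \<in> carrier (add_monoid B)"
    thus "lambda a (x \<otimes>\<^bsub>add_monoid B\<^esub> y) = lambda a x \<otimes>\<^bsub>add_monoid B\<^esub> lambda a y"
      using a by (simp add: lambda_def skew_distrib a_minus_def add.m_assoc)
  qed (use a lambda_closed in simp)
  show "bij_betw (lambda a) (carrier (add_monoid B)) (carrier (add_monoid B))"
  proof (rule bij_betw_byWitness[where f' = "\<lambda>b. inv a \<otimes> (a \<oplus> b)"])
    show "\<forall>b\<in>carrier (add_monoid B). inv a \<otimes> (a \<oplus> lambda a b) = b"
      using a by (simp add: lambda_def add.mult_inv_cancel mult.mult_inv_cancel)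
    show "\<forall>b\<in>carrier (add_monoid B). lambda a (inv a \<otimes> (a \<oplus> b)) = b"
      using a by (simp add: lambda_def add.mult_inv_cancel mult.mult_inv_cancel)
  qed (use a lambda_closed in auto)
qed

text \<open>The value \<open>lambda a b\<close> is \<open>(a \<star> b) \<oplus> b\<close>, and both
  summands lie in \<open>L\<close>.\<close>

lemma left_ideal_lambda_closed:
  assumes "left_ideal L B" and a: "a \<in> carrier B" and b: "b \<in> L"
  shows "lambda a b \<in> L"
proof -
  interpret left_ideal L B by fact
  have bG: "b \<in> carrier B" using subgroup.mem_carrier[OF multiplicative_subgroup b] .
  have "a \<star> b \<in> star_set B (carrier B) L"
    unfolding star_set_def by (rule generate.incl) (use a b in blast)
  hence "a \<star> b \<in> L" using star_closed by blast
  hence "(a \<star> b) \<oplus> b \<in> L"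
    using subgroup.m_closed[OF additive_subgroup _ b] by simp
  moreover have "(a \<star> b) \<oplus> b = lambda a b"
    using a bG lambda_closed[OF a bG] by (simp add: star_eq_lambda a_minus_def add.m_assoc)
  ultimately show ?thesis by simp
qed

text \<open>Closure under the product follows from
  \<open>x \<otimes> y = x \<oplus> lambda x y\<close>, and closure under \<open>\<star>\<close>
  from \<open>a \<star> b = lambda a b \<ominus> b\<close>.\<close>

lemma strong_left_idealI:
  assumes N: "N \<lhd> add_monoid B"
    and lam: "\<And>a b. \<lbrakk> a \<in> carrier B; b \<in> N \<rbrakk> \<Longrightarrow> lambda a b \<in> N"
  shows "strong_left_ideal N B"
proof -
  have addN: "subgroup N (add_monoid B)" using normal_imp_subgroup[OF N] .
  have NG: "x \<in> carrier B" if "x \<in> N" for x using subgroup.mem_carrier[OF addN that] by simp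
  have addcl: "x \<oplus> y \<in> N" if "x \<in> N" "y \<in> N" for x y
    using subgroup.m_closed[OF addN that] by simp
  have mincl: "\<ominus> x \<in> N" if "x \<in> N" for x
    using subgroup.m_inv_closed[OF addN that] by (simp add: a_inv_def)
  have multN: "subgroup N B"
  proof (rule mult.subgroupI)
    show "N \<subseteq> carrier B" using NG by blast
    show "N \<noteq> {}" using subgroup.one_closed[OF addN] by blast
  next
    fix x assume x: "x \<in> N"
    have ix: "inv x \<in> carrier B" using NG[OF x] by simp
    \<comment> \<open>Here \<open>inv x \<otimes> x\<close> is \<open>\<one>\<close>, which equals
      \<open>\<zero>\<close>; so invariance yields the multiplicative inverse up to sign.\<close>
    have "lambda (inv x) x = \<ominus> (inv x)"
      using NG[OF x] by (simp add: lambda_def flip: zero_eq_one)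
    hence "\<ominus> (inv x) \<in> N" using lam[OF ix x] by simp
    hence "\<ominus> (\<ominus> (inv x)) \<in> N" by (rule mincl)
    thus "inv x \<in> N" using ix by simp
  next
    fix x y assume xy: "x \<in> N" "y \<in> N"
    thus "x \<otimes> y \<in> N"
      using mult_eq_add_lambda[OF NG NG] addcl lam NG by simp
  qed
  have "star_set B (carrier B) N \<subseteq> N"
    unfolding star_set_def
  proof (rule group.generate_subgroup_incl[OF additive_group _ addN])
    show "{x \<star> y |x y. x \<in> carrier B \<and> y \<in> N} \<subseteq> N"
      using addcl mincl lam by (auto simp: star_eq_lambda a_minus_def)
  qed
  thus ?thesis
    using addN multN N
    by (simp add: strong_left_ideal_def strong_left_ideal_axioms_def left_ideal_def
        left_ideal_axioms_def subbrace_def)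
qed

end

theorem theorem3:
  fixes B :: "('a, 'm) ring_scheme" (structure)
  assumes "skew_brace B"
    and "finite (carrier B)"
    and "carrier B \<noteq> {\<zero>}"
    and "subbrace A1 B" and "abelian_skew_brace (B\<lparr>carrier := A1\<rparr>)"
    and "subbrace A2 B" and "abelian_skew_brace (B\<lparr>carrier := A2\<rparr>)"
    and "carrier B = A1 <+> A2"
    and "left_ideal A1 B"
  shows "\<exists>I. strong_left_ideal I B \<and> I \<noteq> {\<zero>} \<and> (I \<subseteq> A1 \<or> I \<subseteq> A2)"
proof -
  interpret skew_brace B by fact
  have comm: "x \<oplus> y = y \<oplus> x"
    if "abelian_skew_brace (B\<lparr>carrier := A\<rparr>)" "x \<in> A" "y \<in> A" for A x y
    using comm_groupE(4)[OF abelian_skew_brace.additive_comm_group[OF that(1)]] that(2,3) by simp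
  interpret fac: abelian_factorization "add_monoid B" A1 A2
    by (intro abelian_factorization.intro abelian_factorization_axioms.intro additive_group
        subbrace.additive_subgroup assms(4,6))
      (use comm[OF assms(5)] comm[OF assms(7)] assms(8) in \<open>auto simp: set_add_def\<close>)
  obtain N where N: "N \<lhd> add_monoid B" "N \<noteq> {\<zero>}" "N \<subseteq> A1 \<or> N \<subseteq> A2" "fac.invariant N"
    using fac.exists_invariant_normal_subgroup assms(2,3) by auto
  have "lambda a b \<in> N" if a: "a \<in> carrier B" and b: "b \<in> N" for a b
  proof -
    have "A1 \<subseteq> carrier (add_monoid B)"
      using subgroup.subset[OF subbrace.additive_subgroup[OF assms(4)]] .
    moreover have "lambda a ` A1 \<subseteq> A1" using left_ideal_lambda_closed[OF assms(9) a] by blast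
    \<comment> \<open>\<open>invariant\<close> speaks of automorphisms mapping \<open>A1\<close>
      onto itself; injectivity and finiteness turn the inclusion into an equality.\<close>
    ultimately have "lambda a ` A1 = A1"
      using group.iso_image_eq[OF additive_group _ lambda_iso[OF a]] assms(2) by simp
    thus ?thesis using N(4) lambda_iso[OF a] b unfolding fac.invariant_def by blast
  qed
  thus ?thesis using strong_left_idealI[OF N(1)] N(2,3) by blast
qed

end
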